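(* Let $\mathcal T=(\mathbb T,\mathcal V,\xi)$ be a topological theory with $\bot\neq k$ in $\mathcal V$ and $T1=1$. Let $X$ be a representable $\mathcal T$-category. Then $X$ is totally cocomplete if and only if $X^{\mathrm{op}}$ is totally complete.
   Context: **Theory.** A topological theory $\mathcal T=(\mathbb T,\mathcal V,\xi)$ consists of a monad $\mathbb T=(T,e,m)$ on $\mathsf{Set}$, a commutative unital quantale $\mathcal V=(\mathcal V,\otimes,k)$ (complete lattice, commutative monoid, $\otimes$ preserves suprema in each variable; $x\otimes y\le z\iff x\le\hom(y,z)$) and a map $\xi:T\mathcal V\to\mathcal V$ such that (a) $T$ preserves weak pullbacks and every naturality square of $m$ is a weak pullback; (b) $(\mathcal V,\xi)$ is an Eilenberg–Moore $\mathbb T$-algebra, $\xi\cdot T(\otimes)=\otimes\cdot\langle\xi\cdot T\pi_1,\xi\cdot T\pi_2\rangle$ on $T(\mathcal V\times\mathcal V)$, and $\xi\cdot T(k)$ is constant $k$ on $T1$ (with $k:1\to\mathcal V$); (c) for every map $f:X\to Y$ and $\varphi:X\to\mathcal V$, $\xi\cdot T(f_!\varphi)=(Tf)_!(\xi\cdot T\varphi)$, where $f_!\varphi(y)=\bigvee_{f(x)=y}\varphi(x)$. **Relations.** A $\mathcal V$-relation $r:X\nrightarrow Y$ is a map $X\times Y\to\mathcal V$, ordered pointwise; $(s\cdot r)(x,z)=\bigvee_y r(x,y)\otimes s(y,z)$; $r^\circ(y,x)=r(x,y)$; a map $f$ is identified with the relation with value $k$ if $f(x)=y$ and $\bot$ otherwise.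 $T_\xi r:TX\nrightarrow TY$ is $T_\xi r(\mathfrak x,\mathfrak y)=\bigvee\{\xi\cdot Tr(\mathfrak w)\mid \mathfrak w\in T(X\times Y),T\pi_1(\mathfrak w)=\mathfrak x,T\pi_2(\mathfrak w)=\mathfrak y\}$. **$\mathcal T$-categories.** A $\mathcal T$-category is $(X,a)$ with $a:TX\nrightarrow X$, $e_X^\circ\le a$ and $a\cdot T_\xi a\cdot m_X^\circ\le a$; a $\mathcal T$-functor $f:(X,a)\to(Y,b)$ is a map with $a(\mathfrak x,x)\le b(Tf(\mathfrak x),f(x))$. They form $\mathcal T\text{-}\mathsf{Cat}$. Put $a_0=a\cdot e_X$. For maps into $(Y,b)$: $f\le g$ iff $k\le b_0(f(x),g(x))$ for all $x$; $f\simeq g$ iff $f\le g$ and $g\le f$; $f\dashv g$ means $1\le gf$ and $fg\le 1$. **Representable; duals.** For $X=(X,a)$ let $\hat a=T_\xi a\cdot m_X^\circ$ and $TX=(TX,\hat a\cdot m_X)$, a $\mathcal T$-category. $X$ is representable if $e_X:X\to TX$ has a left adjoint $\alpha:TX\to X$ in $\mathcal T\text{-}\mathsf{Cat}$; then $a=a_0\cdot\alpha$, and the dual $X^{\mathrm{op}}=(X,a_0^\circ\cdot\alpha)$ is a representable $\mathcal T$-category, independent of the choice of $\alpha$. E.g. $TX$ is representable with $(TX)^{\mathrm{op}}=(TX,\hat a^\circ\cdot m_X)$. A $\mathcal T$-functor $f$ between representable $\mathcal T$-categories (with left adjoints $\alpha,\beta$) is a pseudo-homomorphism if $\beta\cdot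 Tf\simeq f\cdot\alpha$. $\mathcal T\text{-}\mathsf{ReprCat}$: representable $\mathcal T$-categories and pseudo-homomorphisms. **Total completeness.** $\mathcal V$ is a $\mathcal T$-category with structure $(\mathfrak v,v)\mapsto\hom(\xi(\mathfrak v),v)$. $\mathcal V^X$ is the set of $\mathcal T$-functors $\varphi:X\to\mathcal V$; $\mathrm{ev}:\mathcal V^X\nrightarrow X$, $\mathrm{ev}(\varphi,x)=\varphi(x)$; $\mu=a\cdot T_\xi\mathrm{ev}$. $VX$ is the $\mathcal T$-category on the set $\mathcal V^X$ with structure $(\mathfrak p,\varphi)\mapsto\bigwedge_{x}\hom(\varphi(x),\mu(\mathfrak p,x))$; it is representable if $X$ is. $\mathsf h_X:X\to VX$, $x\mapsto a_0(x,-)$, is a $\mathcal T$-functor, and a pseudo-homomorphism if $X$ is representable. A representable $X$ is totally complete if $\mathsf h_X$ has a right adjoint in $\mathcal T\text{-}\mathsf{ReprCat}$ (i.e. a right adjoint $\mathcal T$-functor which is a pseudo-homomorphism). **Total cocompleteness.** $PX=\mathcal V^{(TX)^{\mathrm{op}}}$ is the set of $\mathcal T$-functors $\psi:(TX)^{\mathrm{op}}\to\mathcal V$ with the structure of the dual of the representable $\mathcal T$-category $V((TX)^{\mathrm{op}})$, so $(PX)^{\mathrm{op}}=V((TX)^{\mathrm{op}})$. $\mathsf y_X:X\to PX$, $x\mapsto a(-,x)$. $X$ is totally cocomplete if $\mathsf y_X$ has a left adjoint in $\mathcal T\text{-}\mathsf{Cat}$. *)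

theory Defs
  imports "HOL-Library.FuncSet"
begin

section \<open>A universe of sets\<close>

text \<open>
  A monad on Set acts on all sets at once, which cannot be expressed by a HOL type constructor that
  is universally quantified. Set is therefore the category of the sets of a Grothendieck universe:
  a type \<open>'u\<close> with a membership relation \<open>x \<in> elts y\<close> whose axioms are extensionality together
  with the closure conditions of a Grothendieck universe (pairs, power sets - containing all
  subsets in the sense of HOL - and unions of families). Objects are all elements of \<open>'u\<close>; a map
  \<open>X \<rightarrow> Y\<close> is a HOL function in \<open>elts X \<rightarrow> elts Y\<close>, of which only the values on \<open>elts X\<close> matter.
  Every model of ZFC with full second order replacement is an instance; infinity and foundation
  are not required.
\<close>

class grothendieck_universe =
  fixes elts :: "'a \<Rightarrow> 'a set"
  assumes elts_inject: "elts x = elts y \<Longrightarrow> x = y"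
    and ex_upair: "\<exists>z. elts z = {x, y}"
    and ex_power: "\<exists>z. elts ` elts z = Pow (elts x)"
    and ex_union: "\<exists>z. elts z = (\<Union>y\<in>elts x. elts (f y))"

definition small :: "'u::grothendieck_universe set \<Rightarrow> bool" where
  "small A \<longleftrightarrow> A \<in> range elts"

text \<open>The object with a given set of elements; meaningful for small sets only.\<close>

definition set_of :: "'u::grothendieck_universe set \<Rightarrow> 'u" where
  "set_of A = inv elts A"

definition one :: "'u::grothendieck_universe" where
  "one = set_of {set_of {}}"

definition pair :: "'u::grothendieck_universe \<Rightarrow> 'u \<Rightarrow> 'u" where
  "pair x y = set_of {set_of {x}, set_of {x, y}}"

definition pfst :: "'u::grothendieck_universe \<Rightarrow> 'u" where
  "pfst p = (THE x. \<exists>y. p = pair x y)"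

definition psnd :: "'u::grothendieck_universe \<Rightarrow> 'u" where
  "psnd p = (THE y. \<exists>x. p = pair x y)"

definition prodset :: "'u::grothendieck_universe \<Rightarrow> 'u \<Rightarrow> 'u" where
  "prodset X Y = set_of {pair x y | x y. x \<in> elts X \<and> y \<in> elts Y}"

text \<open>The map \<open>f\<close> with domain \<open>X\<close> as an element of the universe, namely its graph.\<close>

definition fun_elt :: "'u::grothendieck_universe \<Rightarrow> ('u \<Rightarrow> 'u) \<Rightarrow> 'u" where
  "fun_elt X f = set_of {pair x (f x) | x. x \<in> elts X}"

definition app :: "'u::grothendieck_universe \<Rightarrow> 'u \<Rightarrow> 'u" where
  "app F x = (THE y. pair x y \<in> elts F)"

text \<open>The sets used below are small, so that \<open>set_of\<close> is meaningful for them.\<close>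

lemma elts_set_of: "small A \<Longrightarrow> elts (set_of A) = A"
  by (simp add: small_def set_of_def f_inv_into_f)

lemma set_of_eq_iff: "small A \<Longrightarrow> small B \<Longrightarrow> set_of A = set_of B \<longleftrightarrow> A = B"
proof
  assume "small A" "small B" "set_of A = set_of B"
  then have "elts (set_of A) = elts (set_of B)" by simp
  then show "A = B" using \<open>small A\<close> \<open>small B\<close> by (simp only: elts_set_of)
qed simp

lemma set_of_elts: "set_of (elts x) = x"
proof -
  have "inj (elts :: 'a \<Rightarrow> 'a set)" by (rule injI) (rule elts_inject)
  then show ?thesis by (simp add: set_of_def inv_f_f)
qed

lemma small_elts: "small (elts x)"
  by (simp add: small_def)

lemma small_subset: "small A \<Longrightarrow> B \<subseteq> A \<Longrightarrow> small B"
proof -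
  assume "small A" "B \<subseteq> A"
  then obtain a where a: "B \<subseteq> elts a" unfolding small_def by blast
  obtain z where "elts ` elts z = Pow (elts a)" using ex_power[of a] by blast
  then have "B \<in> elts ` elts z" using a by simp
  then show "small B" unfolding small_def by blast
qed

lemma small_upair: "small {x, y}"
proof -
  obtain z where "elts z = {x, y}" using ex_upair[of x y] by blast
  then show ?thesis unfolding small_def by (metis rangeI)
qed

lemma small_singleton: "small {x}"
  using small_upair[of x x] by simp

lemma small_empty: "small {}"
  using small_subset[OF small_elts] by blast

lemma small_UN:
  fixes F :: "'u \<Rightarrow> 'u::grothendieck_universe set"
  assumes A: "small A" and F: "\<And>x. x \<in> A \<Longrightarrow> small (F x)"
  shows "small (\<Union>x\<in>A. F x)"
proof -
  obtain a where a: "A = elts a" using A unfolding small_def by blast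
  obtain z where "elts z = (\<Union>y\<in>elts a. elts (set_of (F y)))"
    using ex_union[where x = a and f = "\<lambda>y. set_of (F y)"] by blast
  moreover have "(\<Union>y\<in>elts a. elts (set_of (F y))) = (\<Union>x\<in>A. F x)"
    using F by (simp add: a elts_set_of)
  ultimately show ?thesis using small_elts[of z] by simp
qed

lemma small_image: "small A \<Longrightarrow> small (f ` A)"
  for f :: "'u \<Rightarrow> 'u::grothendieck_universe"
proof -
  assume "small A"
  then have "small (\<Union>x\<in>A. {f x})" by (rule small_UN) (rule small_singleton)
  then show ?thesis by (simp add: UNION_singleton_eq_range)
qed

lemma elts_one: "elts one = {set_of {}}"
  by (simp add: one_def elts_set_of small_singleton)

lemma pair_inject: "pair x y = pair x' y' \<longleftrightarrow> x = x' \<and> y = y'"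
proof
  assume "pair x y = pair x' y'"
  then have "{set_of {x}, set_of {x, y}} = {set_of {x'}, set_of {x', y'}}"
    unfolding pair_def by (simp only: set_of_eq_iff[OF small_upair small_upair])
  then have "{{x}, {x, y}} = {{x'}, {x', y'}}"
    by (simp add: doubleton_eq_iff set_of_eq_iff small_upair small_singleton)
  then show "x = x' \<and> y = y'" by (auto simp: doubleton_eq_iff)
qed simp

lemma pfst_pair: "pfst (pair x y) = x" and psnd_pair: "psnd (pair x y) = y"
  by (auto simp: pfst_def psnd_def pair_inject)

lemma elts_prodset: "elts (prodset X Y) = {pair x y | x y. x \<in> elts X \<and> y \<in> elts Y}"
proof -
  have "small (\<Union>x\<in>elts X. pair x ` elts Y)"
    by (intro small_UN small_image small_elts)
  moreover have "(\<Union>x\<in>elts X. pair x ` elts Y) = {pair x y | x y. x \<in> elts X \<and> y \<in> elts Y}"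
    by auto
  ultimately show ?thesis by (simp add: prodset_def elts_set_of)
qed

lemma elts_fun_elt: "elts (fun_elt X f) = {pair x (f x) | x. x \<in> elts X}"
proof -
  have "{pair x (f x) | x. x \<in> elts X} = (\<lambda>x. pair x (f x)) ` elts X" by auto
  then show ?thesis by (simp add: fun_elt_def elts_set_of small_image small_elts)
qed

lemma app_fun_elt: "x \<in> elts X \<Longrightarrow> app (fun_elt X f) x = f x"
  by (auto simp: app_def elts_fun_elt pair_inject)

lemma fun_elt_cong: "(\<And>x. x \<in> elts X \<Longrightarrow> f x = g x) \<Longrightarrow> fun_elt X f = fun_elt X g"
proof -
  assume "\<And>x. x \<in> elts X \<Longrightarrow> f x = g x"
  then have "{pair x (f x) | x. x \<in> elts X} = {pair x (g x) | x. x \<in> elts X}" by force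
  then show ?thesis by (simp add: fun_elt_def)
qed

lemma small_fun_elts: "small {fun_elt X f | f. f \<in> elts X \<rightarrow> elts Y \<and> P f}"
proof -
  obtain p where p: "elts ` elts p = Pow (elts (prodset X Y))" using ex_power[of "prodset X Y"] by blast
  have "fun_elt X f \<in> elts p" if "f \<in> elts X \<rightarrow> elts Y" for f
  proof -
    have "elts (fun_elt X f) \<in> elts ` elts p"
      using that by (auto simp: p elts_fun_elt elts_prodset pair_inject)
    then show ?thesis using elts_inject by blast
  qed
  then show ?thesis by (intro small_subset[OF small_elts[of p]]) auto
qed


section \<open>Topological theories\<close>

text \<open>Commutative unital quantales; the tensor is \<open>*\<close> and the unit \<open>k\<close> is \<open>1\<close>.\<close>

class comm_quantale = complete_lattice + comm_monoid_mult +
  assumes mult_Sup: "x * Sup A = (SUP y\<in>A. x * y)"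

definition qhom :: "'v::comm_quantale \<Rightarrow> 'v \<Rightarrow> 'v" where
  "qhom y z = Sup {x. x * y \<le> z}"

lemma qhom_adjunction: "x * y \<le> z \<longleftrightarrow> x \<le> qhom y (z::'v::comm_quantale)"
proof
  show "x * y \<le> z \<Longrightarrow> x \<le> qhom y z" by (simp add: qhom_def Sup_upper)
  assume "x \<le> qhom y z"
  moreover have mono: "a * c \<le> b * c" if "a \<le> b" for a b c :: 'v
  proof -
    have "c * Sup {a, b} = (SUP y\<in>{a, b}. c * y)" by (rule mult_Sup)
    then have "c * b = sup (c * a) (c * b)" using that by (simp add: sup_absorb2)
    then show ?thesis by (metis mult.commute sup.cobounded1)
  qed
  ultimately have "x * y \<le> qhom y z * y" by blast
  also have "\<dots> = (SUP x\<in>{x. x * y \<le> z}. y * x)"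
    by (simp add: qhom_def mult_Sup mult.commute[of _ y])
  also have "\<dots> \<le> z" by (rule SUP_least) (simp add: mult.commute)
  finally show "x * y \<le> z" .
qed

text \<open>
  The functor acts on objects by \<open>TO\<close> and on a map \<open>f : X \<rightarrow> Y\<close> by \<open>TM X Y f : TO X \<rightarrow> TO Y\<close>.
  The quantale is a HOL type \<open>'v\<close>; \<open>enc\<close> injects it into the universe, so that its
  image is the set to which the functor is applied.
\<close>

record ('u, 'v) ttheory =
  TO :: "'u \<Rightarrow> 'u"
  TM :: "'u \<Rightarrow> 'u \<Rightarrow> ('u \<Rightarrow> 'u) \<Rightarrow> 'u \<Rightarrow> 'u"
  unit :: "'u \<Rightarrow> 'u \<Rightarrow> 'u"
  mult :: "'u \<Rightarrow> 'u \<Rightarrow> 'u"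
  enc :: "'v \<Rightarrow> 'u"
  xi :: "'u \<Rightarrow> 'v"

definition dec :: "('u, 'v) ttheory \<Rightarrow> 'u \<Rightarrow> 'v" where
  "dec \<T> = inv (enc \<T>)"

definition Vset :: "('u::grothendieck_universe, 'v) ttheory \<Rightarrow> 'u" where
  "Vset \<T> = set_of (range (enc \<T>))"

definition xiT ::
  "('u::grothendieck_universe, 'v) ttheory \<Rightarrow> 'u \<Rightarrow> ('u \<Rightarrow> 'v) \<Rightarrow> 'u \<Rightarrow> 'v" where
  "xiT \<T> X \<phi> t = xi \<T> (TM \<T> X (Vset \<T>) (\<lambda>x. enc \<T> (\<phi> x)) t)"

definition weak_pullback ::
  "'u::grothendieck_universe \<Rightarrow> 'u \<Rightarrow> 'u \<Rightarrow> 'u \<Rightarrow>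
    ('u \<Rightarrow> 'u) \<Rightarrow> ('u \<Rightarrow> 'u) \<Rightarrow> ('u \<Rightarrow> 'u) \<Rightarrow> ('u \<Rightarrow> 'u) \<Rightarrow> bool" where
  "weak_pullback P X Y Z p q f g \<longleftrightarrow>
     p \<in> elts P \<rightarrow> elts X \<and> q \<in> elts P \<rightarrow> elts Y \<and>
     f \<in> elts X \<rightarrow> elts Z \<and> g \<in> elts Y \<rightarrow> elts Z \<and>
     (\<forall>w\<in>elts P. f (p w) = g (q w)) \<and>
     (\<forall>(Q::'u) p' q'. p' \<in> elts Q \<rightarrow> elts X \<longrightarrow> q' \<in> elts Q \<rightarrow> elts Y \<longrightarrow>
        (\<forall>w\<in>elts Q. f (p' w) = g (q' w)) \<longrightarrow>
        (\<exists>u \<in> elts Q \<rightarrow> elts P. \<forall>w\<in>elts Q. p (u w) = p' w \<and> q (u w) = q' w))"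

text \<open>The left Kan extension \<open>f\<^sub>!\<phi>\<close> of \<open>\<phi> : X \<rightarrow> V\<close> along a map \<open>f\<close> with domain \<open>X\<close>.\<close>

definition shriek ::
  "'u::grothendieck_universe \<Rightarrow> ('u \<Rightarrow> 'u) \<Rightarrow> ('u \<Rightarrow> 'v::complete_lattice) \<Rightarrow> 'u \<Rightarrow> 'v" where
  "shriek X f \<phi> y = Sup {\<phi> x | x. x \<in> elts X \<and> f x = y}"

locale set_monad =
  fixes \<T> :: "('u::grothendieck_universe, 'v) ttheory"
  assumes TM_closed: "f \<in> elts X \<rightarrow> elts Y \<Longrightarrow> TM \<T> X Y f \<in> elts (TO \<T> X) \<rightarrow> elts (TO \<T> Y)"
    and TM_cong: "\<lbrakk>f \<in> elts X \<rightarrow> elts Y; \<And>x. x \<in> elts X \<Longrightarrow> f x = g x; t \<in> elts (TO \<T> X)\<rbrakk>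
      \<Longrightarrow> TM \<T> X Y f t = TM \<T> X Y g t"
    and TM_id: "t \<in> elts (TO \<T> X) \<Longrightarrow> TM \<T> X X (\<lambda>x. x) t = t"
    and TM_comp: "\<lbrakk>f \<in> elts X \<rightarrow> elts Y; g \<in> elts Y \<rightarrow> elts Z; t \<in> elts (TO \<T> X)\<rbrakk>
      \<Longrightarrow> TM \<T> X Z (\<lambda>x. g (f x)) t = TM \<T> Y Z g (TM \<T> X Y f t)"
    and unit_closed: "unit \<T> X \<in> elts X \<rightarrow> elts (TO \<T> X)"
    and unit_natural: "\<lbrakk>f \<in> elts X \<rightarrow> elts Y; x \<in> elts X\<rbrakk>
      \<Longrightarrow> TM \<T> X Y f (unit \<T> X x) = unit \<T> Y (f x)"
    and mult_closed: "mult \<T> X \<in> elts (TO \<T> (TO \<T> X)) \<rightarrow> elts (TO \<T> X)"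
    and mult_natural: "\<lbrakk>f \<in> elts X \<rightarrow> elts Y; t \<in> elts (TO \<T> (TO \<T> X))\<rbrakk>
      \<Longrightarrow> TM \<T> X Y f (mult \<T> X t) = mult \<T> Y (TM \<T> (TO \<T> X) (TO \<T> Y) (TM \<T> X Y f) t)"
    and mult_unit: "t \<in> elts (TO \<T> X) \<Longrightarrow> mult \<T> X (unit \<T> (TO \<T> X) t) = t"
    and mult_T_unit: "t \<in> elts (TO \<T> X)
      \<Longrightarrow> mult \<T> X (TM \<T> X (TO \<T> X) (unit \<T> X) t) = t"
    and mult_assoc: "t \<in> elts (TO \<T> (TO \<T> (TO \<T> X)))
      \<Longrightarrow> mult \<T> X (mult \<T> (TO \<T> X) t) =
          mult \<T> X (TM \<T> (TO \<T> (TO \<T> X)) (TO \<T> X) (mult \<T> X) t)"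

locale topological_theory = set_monad \<T>
  for \<T> :: "('u::grothendieck_universe, 'v::comm_quantale) ttheory" +
  assumes enc_inj: "inj (enc \<T>)"
    and enc_small: "small (range (enc \<T>))"
    and T_weak_pullback: "weak_pullback P X Y Z p q f g \<Longrightarrow>
      weak_pullback (TO \<T> P) (TO \<T> X) (TO \<T> Y) (TO \<T> Z)
        (TM \<T> P X p) (TM \<T> P Y q) (TM \<T> X Z f) (TM \<T> Y Z g)"
    and mult_weak_pullback: "f \<in> elts X \<rightarrow> elts Y \<Longrightarrow>
      weak_pullback (TO \<T> (TO \<T> X)) (TO \<T> X) (TO \<T> (TO \<T> Y)) (TO \<T> Y)
        (mult \<T> X) (TM \<T> (TO \<T> X) (TO \<T> Y) (TM \<T> X Y f)) (TM \<T> X Y f) (mult \<T> Y)"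
    and xi_unit: "xi \<T> (unit \<T> (Vset \<T>) (enc \<T> v)) = v"
    and xi_mult: "t \<in> elts (TO \<T> (TO \<T> (Vset \<T>)))
      \<Longrightarrow> xi \<T> (mult \<T> (Vset \<T>) t) = xiT \<T> (TO \<T> (Vset \<T>)) (xi \<T>) t"
    and xi_tensor: "t \<in> elts (TO \<T> (prodset (Vset \<T>) (Vset \<T>)))
      \<Longrightarrow> xiT \<T> (prodset (Vset \<T>) (Vset \<T>)) (\<lambda>p. dec \<T> (pfst p) * dec \<T> (psnd p)) t =
          xi \<T> (TM \<T> (prodset (Vset \<T>) (Vset \<T>)) (Vset \<T>) pfst t) *
          xi \<T> (TM \<T> (prodset (Vset \<T>) (Vset \<T>)) (Vset \<T>) psnd t)"
    and xi_k: "t \<in> elts (TO \<T> one) \<Longrightarrow> xiT \<T> one (\<lambda>_. 1) t = 1"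
    and xi_shriek: "\<lbrakk>f \<in> elts X \<rightarrow> elts Y; t \<in> elts (TO \<T> Y)\<rbrakk>
      \<Longrightarrow> xiT \<T> Y (shriek X f \<phi>) t = shriek (TO \<T> X) (TM \<T> X Y f) (xiT \<T> X \<phi>) t"


section \<open>Relations\<close>

text \<open>
  A relation from \<open>X\<close> to \<open>Y\<close> is a function \<open>r :: 'u \<Rightarrow> 'u \<Rightarrow> 'v\<close>, considered on
  \<open>elts X \<times> elts Y\<close> only.
\<close>

definition rel_le ::
  "'u::grothendieck_universe \<Rightarrow> 'u \<Rightarrow> ('u \<Rightarrow> 'u \<Rightarrow> 'v::order) \<Rightarrow> ('u \<Rightarrow> 'u \<Rightarrow> 'v) \<Rightarrow> bool" where
  "rel_le X Y r s \<longleftrightarrow> (\<forall>x\<in>elts X. \<forall>y\<in>elts Y. r x y \<le> s x y)"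

text \<open>\<open>rcomp Y s r\<close> is \<open>s \<cdot> r\<close>, where \<open>Y\<close> is the target of \<open>r\<close> and the source of \<open>s\<close>.\<close>

definition rcomp ::
  "'u::grothendieck_universe \<Rightarrow> ('u \<Rightarrow> 'u \<Rightarrow> 'v::comm_quantale) \<Rightarrow> ('u \<Rightarrow> 'u \<Rightarrow> 'v) \<Rightarrow>
    'u \<Rightarrow> 'u \<Rightarrow> 'v" where
  "rcomp Y s r x z = (SUP y\<in>elts Y. r x y * s y z)"

definition rconv :: "('u \<Rightarrow> 'u \<Rightarrow> 'v) \<Rightarrow> 'u \<Rightarrow> 'u \<Rightarrow> 'v" where
  "rconv r y x = r x y"

definition rmap :: "('u \<Rightarrow> 'u) \<Rightarrow> 'u \<Rightarrow> 'u \<Rightarrow> 'v::comm_quantale" where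
  "rmap f x y = (if f x = y then 1 else bot)"

definition Txi :: "('u::grothendieck_universe, 'v::comm_quantale) ttheory \<Rightarrow> 'u \<Rightarrow> 'u \<Rightarrow>
    ('u \<Rightarrow> 'u \<Rightarrow> 'v) \<Rightarrow> 'u \<Rightarrow> 'u \<Rightarrow> 'v" where
  "Txi \<T> X Y r s t =
     Sup {xiT \<T> (prodset X Y) (\<lambda>p. r (pfst p) (psnd p)) w | w.
            w \<in> elts (TO \<T> (prodset X Y)) \<and>
            TM \<T> (prodset X Y) X pfst w = s \<and> TM \<T> (prodset X Y) Y psnd w = t}"


section \<open>Categories over a topological theory\<close>

record ('u, 'v) tcat =
  obj :: 'u
  str :: "'u \<Rightarrow> 'u \<Rightarrow> 'v"

text \<open>The relation \<open>T\<^sub>\<xi>a \<cdot> m\<degree>\<close> (written with a hat over \<open>a\<close>), from \<open>TX\<close> to \<open>TX\<close>.\<close>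

definition hat :: "('u::grothendieck_universe, 'v::comm_quantale) ttheory \<Rightarrow> ('u, 'v) tcat \<Rightarrow>
    'u \<Rightarrow> 'u \<Rightarrow> 'v" where
  "hat \<T> X = rcomp (TO \<T> (TO \<T> (obj X)))
     (Txi \<T> (TO \<T> (obj X)) (obj X) (str X)) (rconv (rmap (mult \<T> (obj X))))"

definition tcategory ::
  "('u::grothendieck_universe, 'v::comm_quantale) ttheory \<Rightarrow> ('u, 'v) tcat \<Rightarrow> bool" where
  "tcategory \<T> X \<longleftrightarrow>
     rel_le (TO \<T> (obj X)) (obj X) (rconv (rmap (unit \<T> (obj X)))) (str X) \<and>
     rel_le (TO \<T> (obj X)) (obj X) (rcomp (TO \<T> (obj X)) (str X) (hat \<T> X)) (str X)"

definition tfunctor :: "('u::grothendieck_universe, 'v::comm_quantale) ttheory \<Rightarrow>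
    ('u, 'v) tcat \<Rightarrow> ('u, 'v) tcat \<Rightarrow> ('u \<Rightarrow> 'u) \<Rightarrow> bool" where
  "tfunctor \<T> X Y f \<longleftrightarrow> f \<in> elts (obj X) \<rightarrow> elts (obj Y) \<and>
     (\<forall>t\<in>elts (TO \<T> (obj X)). \<forall>x\<in>elts (obj X).
        str X t x \<le> str Y (TM \<T> (obj X) (obj Y) f t) (f x))"

text \<open>\<open>str0 \<T> X\<close> is \<open>a\<^sub>0 = a \<cdot> e\<close>.\<close>

definition str0 :: "('u::grothendieck_universe, 'v::comm_quantale) ttheory \<Rightarrow> ('u, 'v) tcat \<Rightarrow>
    'u \<Rightarrow> 'u \<Rightarrow> 'v" where
  "str0 \<T> X = rcomp (TO \<T> (obj X)) (str X) (rmap (unit \<T> (obj X)))"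

text \<open>The order on maps from the set \<open>D\<close> to \<open>Y\<close>.\<close>

definition map_le :: "('u::grothendieck_universe, 'v::comm_quantale) ttheory \<Rightarrow> 'u \<Rightarrow>
    ('u, 'v) tcat \<Rightarrow> ('u \<Rightarrow> 'u) \<Rightarrow> ('u \<Rightarrow> 'u) \<Rightarrow> bool" where
  "map_le \<T> D Y f g \<longleftrightarrow> (\<forall>x\<in>elts D. 1 \<le> str0 \<T> Y (f x) (g x))"

definition map_equiv :: "('u::grothendieck_universe, 'v::comm_quantale) ttheory \<Rightarrow> 'u \<Rightarrow>
    ('u, 'v) tcat \<Rightarrow> ('u \<Rightarrow> 'u) \<Rightarrow> ('u \<Rightarrow> 'u) \<Rightarrow> bool" where
  "map_equiv \<T> D Y f g \<longleftrightarrow> map_le \<T> D Y f g \<and> map_le \<T> D Y g f"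

text \<open>\<open>f : X \<rightarrow> Y\<close> is left adjoint to \<open>g : Y \<rightarrow> X\<close>.\<close>

definition adjoint :: "('u::grothendieck_universe, 'v::comm_quantale) ttheory \<Rightarrow>
    ('u, 'v) tcat \<Rightarrow> ('u, 'v) tcat \<Rightarrow> ('u \<Rightarrow> 'u) \<Rightarrow> ('u \<Rightarrow> 'u) \<Rightarrow> bool" where
  "adjoint \<T> X Y f g \<longleftrightarrow> tfunctor \<T> X Y f \<and> tfunctor \<T> Y X g \<and>
     map_le \<T> (obj X) X (\<lambda>x. x) (\<lambda>x. g (f x)) \<and> map_le \<T> (obj Y) Y (\<lambda>y. f (g y)) (\<lambda>y. y)"


section \<open>Representable categories and duals\<close>

definition Tcat ::
  "('u::grothendieck_universe, 'v::comm_quantale) ttheory \<Rightarrow> ('u, 'v) tcat \<Rightarrow> ('u, 'v) tcat" where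
  "Tcat \<T> X = \<lparr>obj = TO \<T> (obj X),
     str = rcomp (TO \<T> (obj X)) (hat \<T> X) (rmap (mult \<T> (obj X)))\<rparr>"

definition representable ::
  "('u::grothendieck_universe, 'v::comm_quantale) ttheory \<Rightarrow> ('u, 'v) tcat \<Rightarrow> bool" where
  "representable \<T> X \<longleftrightarrow> tcategory \<T> X \<and> (\<exists>\<alpha>. adjoint \<T> (Tcat \<T> X) X \<alpha> (unit \<T> (obj X)))"

text \<open>
  A chosen left adjoint \<open>\<alpha>\<close> of the unit; it is determined up to equivalence, and the notions
  below do not depend on the choice.
\<close>

definition rep_map ::
  "('u::grothendieck_universe, 'v::comm_quantale) ttheory \<Rightarrow> ('u, 'v) tcat \<Rightarrow> 'u \<Rightarrow> 'u" where
  "rep_map \<T> X = (SOME \<alpha>. adjoint \<T> (Tcat \<T> X) X \<alpha> (unit \<T> (obj X)))"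

definition dual ::
  "('u::grothendieck_universe, 'v::comm_quantale) ttheory \<Rightarrow> ('u, 'v) tcat \<Rightarrow> ('u, 'v) tcat" where
  "dual \<T> X = \<lparr>obj = obj X, str = rcomp (obj X) (rconv (str0 \<T> X)) (rmap (rep_map \<T> X))\<rparr>"

definition pseudo_hom :: "('u::grothendieck_universe, 'v::comm_quantale) ttheory \<Rightarrow>
    ('u, 'v) tcat \<Rightarrow> ('u, 'v) tcat \<Rightarrow> ('u \<Rightarrow> 'u) \<Rightarrow> bool" where
  "pseudo_hom \<T> X Y f \<longleftrightarrow> representable \<T> X \<and> representable \<T> Y \<and> tfunctor \<T> X Y f \<and>
     map_equiv \<T> (TO \<T> (obj X)) Y
       (\<lambda>t. rep_map \<T> Y (TM \<T> (obj X) (obj Y) f t)) (\<lambda>t. f (rep_map \<T> X t))"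


section \<open>Total completeness and total cocompleteness\<close>

definition quantale_cat ::
  "('u::grothendieck_universe, 'v::comm_quantale) ttheory \<Rightarrow> ('u, 'v) tcat" where
  "quantale_cat \<T> = \<lparr>obj = Vset \<T>, str = (\<lambda>t v. qhom (xi \<T> t) (dec \<T> v))\<rparr>"

definition presheaves ::
  "('u::grothendieck_universe, 'v::comm_quantale) ttheory \<Rightarrow> ('u, 'v) tcat \<Rightarrow> 'u" where
  "presheaves \<T> X = set_of {fun_elt (obj X) f | f. tfunctor \<T> X (quantale_cat \<T>) f}"

lemma elts_presheaves:
  "elts (presheaves \<T> X) = {fun_elt (obj X) f | f. tfunctor \<T> X (quantale_cat \<T>) f}"
proof -
  have "small {fun_elt (obj X) f | f. tfunctor \<T> X (quantale_cat \<T>) f}"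
  proof (rule small_subset[OF small_fun_elts])
    show "{fun_elt (obj X) f | f. tfunctor \<T> X (quantale_cat \<T>) f} \<subseteq>
      {fun_elt (obj X) f | f. f \<in> elts (obj X) \<rightarrow> elts (obj (quantale_cat \<T>)) \<and>
        tfunctor \<T> X (quantale_cat \<T>) f}"
      by (auto simp only: tfunctor_def)
  qed
  then show ?thesis by (simp add: presheaves_def elts_set_of)
qed

definition ev :: "('u::grothendieck_universe, 'v::comm_quantale) ttheory \<Rightarrow> 'u \<Rightarrow> 'u \<Rightarrow> 'v" where
  "ev \<T> \<phi> x = dec \<T> (app \<phi> x)"

definition mu :: "('u::grothendieck_universe, 'v::comm_quantale) ttheory \<Rightarrow> ('u, 'v) tcat \<Rightarrow>
    'u \<Rightarrow> 'u \<Rightarrow> 'v" where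
  "mu \<T> X = rcomp (TO \<T> (obj X)) (str X) (Txi \<T> (presheaves \<T> X) (obj X) (ev \<T>))"

definition Vcat ::
  "('u::grothendieck_universe, 'v::comm_quantale) ttheory \<Rightarrow> ('u, 'v) tcat \<Rightarrow> ('u, 'v) tcat" where
  "Vcat \<T> X = \<lparr>obj = presheaves \<T> X,
     str = (\<lambda>p \<phi>. INF x\<in>elts (obj X). qhom (ev \<T> \<phi> x) (mu \<T> X p x))\<rparr>"

definition hmap ::
  "('u::grothendieck_universe, 'v::comm_quantale) ttheory \<Rightarrow> ('u, 'v) tcat \<Rightarrow> 'u \<Rightarrow> 'u" where
  "hmap \<T> X x = fun_elt (obj X) (\<lambda>y. enc \<T> (str0 \<T> X x y))"

definition totally_complete ::
  "('u::grothendieck_universe, 'v::comm_quantale) ttheory \<Rightarrow> ('u, 'v) tcat \<Rightarrow> bool" where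
  "totally_complete \<T> X \<longleftrightarrow> representable \<T> X \<and>
     (\<exists>g. adjoint \<T> X (Vcat \<T> X) (hmap \<T> X) g \<and> pseudo_hom \<T> (Vcat \<T> X) X g)"

definition Pcat ::
  "('u::grothendieck_universe, 'v::comm_quantale) ttheory \<Rightarrow> ('u, 'v) tcat \<Rightarrow> ('u, 'v) tcat" where
  "Pcat \<T> X = dual \<T> (Vcat \<T> (dual \<T> (Tcat \<T> X)))"

definition ymap ::
  "('u::grothendieck_universe, 'v::comm_quantale) ttheory \<Rightarrow> ('u, 'v) tcat \<Rightarrow> 'u \<Rightarrow> 'u" where
  "ymap \<T> X x = fun_elt (TO \<T> (obj X)) (\<lambda>t. enc \<T> (str X t x))"

definition totally_cocomplete ::
  "('u::grothendieck_universe, 'v::comm_quantale) ttheory \<Rightarrow> ('u, 'v) tcat \<Rightarrow> bool" where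
  "totally_cocomplete \<T> X \<longleftrightarrow> (\<exists>f. adjoint \<T> (Pcat \<T> X) X f (ymap \<T> X))"

end

theory Submission
  imports Defs
begin

text \<open>
  Write \<open>D\<close> for the dual of \<open>X\<close>. Every representable category is an ordered pseudo-algebra: a
  relation \<open>a\<^sub>0\<close> that is reflexive and transitive, together with a monotone map \<open>\<alpha> : TX \<rightarrow> X\<close> that
  satisfies the algebra laws up to equivalence, the structure being \<open>a\<^sub>0 \<cdot> \<alpha>\<close>. In this description
  (locale \<open>algebra_presentation\<close>, lemmas \<open>representable_presentation\<close> and \<open>representable\<close>) the
  dual merely reverses \<open>a\<^sub>0\<close> and keeps \<open>\<alpha>\<close>, functors are lax homomorphisms, and
  pseudo-homomorphisms dualise. All categories of the theorem are representable, with explicit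
  presentations: \<open>TX\<close> carries the multiplication of the monad, and copresheaf categories carry the
  algebra sending \<open>p\<close> to \<open>mu p\<close>.

  A left adjoint between representable categories is automatically a pseudo-homomorphism
  (\<open>left_adjoint_pseudo_hom\<close>), and the embedding \<open>hmap\<close> is one too. Dualising therefore turns total
  completeness of \<open>D\<close> into: the functor \<open>hmap : X \<rightarrow> V(D)\<^sup>o\<^sup>p\<close> has a left adjoint
  (\<open>totally_complete_dual_iff\<close>). On the other side, total cocompleteness asks for a left
  adjoint of the Yoneda functor \<open>X \<rightarrow> PX\<close>. Since \<open>a = a\<^sub>0 \<cdot> \<alpha>\<close>, the Yoneda functor is \<open>hmap\<close>
  followed by \<open>F \<mapsto> F \<cdot> \<alpha>\<close>, a functor \<open>V(D)\<^sup>o\<^sup>p \<rightarrow> PX\<close>. This functor reflects the order, because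
  \<open>\<alpha>\<close> is onto up to equivalence, and it has a left adjoint (\<open>left_kan_adjoint\<close>), the left Kan
  extension along \<open>\<alpha>\<close>. Composing adjoints gives one direction (\<open>adjoint_comp\<close>) and cancelling
  the order-reflecting factor gives the other (\<open>adjoint_cancel\<close>).

  The work lies in the extension of relations along the monad: it preserves composition and is
  compatible with the multiplication, by the axioms on weak pullbacks and left Kan extensions. The
  hypothesis \<open>T1 = 1\<close> enters through \<open>Txi_row\<close>: extending a single copresheaf to \<open>TX\<close> agrees with
  extending the evaluation relation at a principal element, and so copresheaf categories are closed
  under the algebra structure \<open>mu\<close> and under left Kan extension.
\<close>

section \<open>Quantales and weak pullbacks\<close>

lemma tensor_mono: "a \<le> b \<Longrightarrow> c \<le> d \<Longrightarrow> a * c \<le> b * d"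
  for a b c d :: "'v::comm_quantale"
proof -
  have mono: "u \<le> v \<Longrightarrow> u * w \<le> v * w" for u v w :: 'v
    using qhom_adjunction[of u w "v * w"] qhom_adjunction[of v w "v * w"] by fastforce
  assume "a \<le> b" "c \<le> d"
  then have "a * c \<le> b * c" "c * b \<le> d * b" by (auto intro: mono)
  then show ?thesis by (simp add: mult.commute)
qed

lemma tensor_SUP: "c * (SUP x\<in>A. f x) = (SUP x\<in>A. c * f x)"
  for c :: "'v::comm_quantale"
  using mult_Sup[of c "f ` A"] by (simp add: image_image)

lemma SUP_tensor: "(SUP x\<in>A. f x) * c = (SUP x\<in>A. f x * c)"
  for c :: "'v::comm_quantale"
  using tensor_SUP[of c f A] by (simp add: mult.commute)

lemma bot_tensor: "bot * c = (bot::'v::comm_quantale)"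
  using mult_Sup[of c "{}"] by (simp add: mult.commute)

lemma unit_le_tensor: "1 \<le> u \<Longrightarrow> v \<le> u * v"
  for u v :: "'v::comm_quantale"
  using tensor_mono[of 1 u v v] by simp

lemma tensor_le_if_le: "1 \<le> u \<Longrightarrow> u * v \<le> w \<Longrightarrow> v \<le> w"
  for u v w :: "'v::comm_quantale"
  using unit_le_tensor[of u v] by (rule order_trans)

lemma unit_le_qhom: "1 \<le> qhom y z \<longleftrightarrow> y \<le> z"
  using qhom_adjunction[of 1 y z] by simp

lemma rcomp_upper: "y \<in> elts Y \<Longrightarrow> r x y * s y z \<le> rcomp Y s r x z"
  unfolding rcomp_def by (rule SUP_upper)

lemma rcomp_rmap: "f x \<in> elts Y \<Longrightarrow> rcomp Y s (rmap f) x z = s (f x) z"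
  unfolding rcomp_def rmap_def
  by (rule antisym) (auto intro!: SUP_least SUP_upper2[of "f x"] simp: bot_tensor)

lemma weak_pullback_lift:
  fixes P :: "'u::grothendieck_universe"
  assumes "weak_pullback P X Y Z p q f g" "x \<in> elts X" "y \<in> elts Y" "f x = g y"
  shows "\<exists>w\<in>elts P. p w = x \<and> q w = y"
proof -
  have "\<exists>u \<in> elts one \<rightarrow> elts P. \<forall>w\<in>elts (one :: 'u). p (u w) = x \<and> q (u w) = y"
    using assms(1)[unfolded weak_pullback_def, THEN conjunct2, THEN conjunct2, THEN conjunct2,
        THEN conjunct2, THEN conjunct2, rule_format, of "\<lambda>_. x" one "\<lambda>_. y"] assms(2-4)
    by simp
  then show ?thesis by (auto simp: elts_one)
qed

lemma weak_pullbackI: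
  assumes "p \<in> elts P \<rightarrow> elts X" "q \<in> elts P \<rightarrow> elts Y" "f \<in> elts X \<rightarrow> elts Z" "g \<in> elts Y \<rightarrow> elts Z"
    and "\<And>w. w \<in> elts P \<Longrightarrow> f (p w) = g (q w)"
    and lift: "\<And>x y. x \<in> elts X \<Longrightarrow> y \<in> elts Y \<Longrightarrow> f x = g y \<Longrightarrow> \<exists>w\<in>elts P. p w = x \<and> q w = y"
  shows "weak_pullback P X Y Z p q f g"
  unfolding weak_pullback_def
proof (intro conjI allI impI)
  fix Q :: 'a and p' q'
  assume *: "p' \<in> elts Q \<rightarrow> elts X" "q' \<in> elts Q \<rightarrow> elts Y" "\<forall>w\<in>elts Q. f (p' w) = g (q' w)"
  have "\<forall>w\<in>elts Q. \<exists>u. u \<in> elts P \<and> p u = p' w \<and> q u = q' w"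
  proof
    fix w assume "w \<in> elts Q"
    then show "\<exists>u. u \<in> elts P \<and> p u = p' w \<and> q u = q' w"
      using lift[of "p' w" "q' w"] * by (auto simp: Pi_iff)
  qed
  from bchoice[OF this] obtain u where "\<forall>w\<in>elts Q. u w \<in> elts P \<and> p (u w) = p' w \<and> q (u w) = q' w"
    by blast
  then show "\<exists>u\<in>elts Q \<rightarrow> elts P. \<forall>w\<in>elts Q. p (u w) = p' w \<and> q (u w) = q' w"
    by (intro bexI[of _ u]) auto
qed (use assms in auto)

lemma pair_in_prodset: "pair x y \<in> elts (prodset X Y) \<longleftrightarrow> x \<in> elts X \<and> y \<in> elts Y"
  by (auto simp: elts_prodset pair_inject)

lemma pfst_closed: "p \<in> elts (prodset X Y) \<Longrightarrow> pfst p \<in> elts X"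
  and psnd_closed: "p \<in> elts (prodset X Y) \<Longrightarrow> psnd p \<in> elts Y"
  and pair_collapse: "p \<in> elts (prodset X Y) \<Longrightarrow> pair (pfst p) (psnd p) = p"
  by (auto simp: elts_prodset pfst_pair psnd_pair)

lemmas prodset_simps = pair_in_prodset pfst_pair psnd_pair pair_collapse pfst_closed psnd_closed

section \<open>Extending quantale-valued maps along the monad\<close>

context topological_theory
begin

lemma TM_in: "f \<in> elts X \<rightarrow> elts Y \<Longrightarrow> t \<in> elts (TO \<T> X) \<Longrightarrow> TM \<T> X Y f t \<in> elts (TO \<T> Y)"
  using TM_closed by (auto simp: Pi_iff)

lemma unit_in: "x \<in> elts X \<Longrightarrow> unit \<T> X x \<in> elts (TO \<T> X)"
  using unit_closed by (auto simp: Pi_iff)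

lemma mult_in: "t \<in> elts (TO \<T> (TO \<T> X)) \<Longrightarrow> mult \<T> X t \<in> elts (TO \<T> X)"
  using mult_closed by (auto simp: Pi_iff)

lemma elts_Vset: "elts (Vset \<T>) = range (enc \<T>)"
  by (simp add: Vset_def elts_set_of enc_small)

lemma dec_enc: "dec \<T> (enc \<T> v) = v"
  by (simp add: dec_def enc_inj)

lemma enc_in: "(\<lambda>x. enc \<T> (\<phi> x)) \<in> A \<rightarrow> elts (Vset \<T>)"
  by (simp add: elts_Vset)

lemma xiT_cong:
  assumes "\<And>x. x \<in> elts X \<Longrightarrow> \<phi> x = \<psi> x" "t \<in> elts (TO \<T> X)"
  shows "xiT \<T> X \<phi> t = xiT \<T> X \<psi> t"
  unfolding xiT_def using TM_cong[OF enc_in _ assms(2)] assms(1) by metis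

lemma xiT_comp:
  assumes "f \<in> elts X \<rightarrow> elts Y" "t \<in> elts (TO \<T> X)"
  shows "xiT \<T> X (\<lambda>x. \<phi> (f x)) t = xiT \<T> Y \<phi> (TM \<T> X Y f t)"
  unfolding xiT_def using TM_comp[OF assms(1) enc_in assms(2)] by simp

lemma xiT_unit: "x \<in> elts X \<Longrightarrow> xiT \<T> X \<phi> (unit \<T> X x) = \<phi> x"
  unfolding xiT_def by (simp add: unit_natural[OF enc_in] xi_unit)

lemma xiT_mult:
  assumes "t \<in> elts (TO \<T> (TO \<T> X))"
  shows "xiT \<T> X \<phi> (mult \<T> X t) = xiT \<T> (TO \<T> X) (xiT \<T> X \<phi>) t"
proof -
  let ?f = "\<lambda>x. enc \<T> (\<phi> x)" and ?V = "Vset \<T>"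
  have f: "?f \<in> elts X \<rightarrow> elts ?V" by (rule enc_in)
  have "xiT \<T> X \<phi> (mult \<T> X t) = xi \<T> (mult \<T> ?V (TM \<T> (TO \<T> X) (TO \<T> ?V) (TM \<T> X ?V ?f) t))"
    unfolding xiT_def by (simp add: mult_natural[OF f assms])
  also have "\<dots> = xiT \<T> (TO \<T> ?V) (xi \<T>) (TM \<T> (TO \<T> X) (TO \<T> ?V) (TM \<T> X ?V ?f) t)"
    by (intro xi_mult TM_in TM_closed f assms)
  also have "\<dots> = xiT \<T> (TO \<T> X) (\<lambda>s. xi \<T> (TM \<T> X ?V ?f s)) t"
    by (rule xiT_comp[symmetric]) (intro TM_closed f assms)+
  finally show ?thesis by (simp add: xiT_def)
qed

lemma xiT_tensor:
  assumes "t \<in> elts (TO \<T> X)"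
  shows "xiT \<T> X (\<lambda>x. \<phi> x * \<psi> x) t = xiT \<T> X \<phi> t * xiT \<T> X \<psi> t"
proof -
  let ?V = "Vset \<T>" and ?g = "\<lambda>x. pair (enc \<T> (\<phi> x)) (enc \<T> (\<psi> x))"
  let ?VV = "prodset ?V ?V"
  have g: "?g \<in> elts X \<rightarrow> elts ?VV" by (simp add: pair_in_prodset elts_Vset)
  have p: "pfst \<in> elts ?VV \<rightarrow> elts ?V" "psnd \<in> elts ?VV \<rightarrow> elts ?V"
    by (auto intro: pfst_closed psnd_closed)
  have "xiT \<T> X (\<lambda>x. \<phi> x * \<psi> x) t =
      xiT \<T> ?VV (\<lambda>p. dec \<T> (pfst p) * dec \<T> (psnd p)) (TM \<T> X ?VV ?g t)"
    using xiT_comp[OF g assms, of "\<lambda>p. dec \<T> (pfst p) * dec \<T> (psnd p)"]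
    by (simp add: pfst_pair psnd_pair dec_enc)
  also have "\<dots> = xi \<T> (TM \<T> ?VV ?V pfst (TM \<T> X ?VV ?g t)) * xi \<T> (TM \<T> ?VV ?V psnd (TM \<T> X ?VV ?g t))"
    by (intro xi_tensor TM_in g assms)
  also have "\<dots> = xiT \<T> X \<phi> t * xiT \<T> X \<psi> t"
    unfolding xiT_def TM_comp[OF g p(1) assms, symmetric] TM_comp[OF g p(2) assms, symmetric]
    by (simp add: pfst_pair psnd_pair)
  finally show ?thesis .
qed

lemma xiT_one:
  assumes "t \<in> elts (TO \<T> X)"
  shows "xiT \<T> X (\<lambda>_. 1) t = 1"
proof -
  have f: "(\<lambda>_. set_of {}) \<in> elts X \<rightarrow> elts one" by (simp add: elts_one)
  show ?thesis using xiT_comp[OF f assms, of "\<lambda>_. 1"] xi_k[OF TM_in[OF f assms]] by simp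
qed

text \<open>
  Monotonicity is hidden in the axiom on left Kan extensions: \<open>\<psi>\<close> is the left Kan extension, along
  the projection \<open>X \<times> V \<rightarrow> X\<close>, of the map sending \<open>(x, v)\<close> to \<open>v\<close> if \<open>v \<le> \<psi> x\<close> and to bottom
  otherwise, and any \<open>\<phi> \<le> \<psi>\<close> is a restriction of that map along a section of the projection.
\<close>

lemma xiT_mono:
  assumes le: "\<And>x. x \<in> elts X \<Longrightarrow> \<phi> x \<le> \<psi> x" and t: "t \<in> elts (TO \<T> X)"
  shows "xiT \<T> X \<phi> t \<le> xiT \<T> X \<psi> t"
proof -
  define S where "S = prodset X (Vset \<T>)"
  define \<Phi> where "\<Phi> p = (if dec \<T> (psnd p) \<le> \<psi> (pfst p) then dec \<T> (psnd p) else bot)" for p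
  let ?s = "\<lambda>x. pair x (enc \<T> (\<phi> x))"
  have s: "?s \<in> elts X \<rightarrow> elts S" by (auto simp: S_def pair_in_prodset elts_Vset)
  have f: "pfst \<in> elts S \<rightarrow> elts X" by (auto simp: S_def pfst_closed)
  have kan: "shriek S pfst \<Phi> x = \<psi> x" if "x \<in> elts X" for x
    unfolding shriek_def
  proof (rule Sup_eqI)
    fix y assume "\<And>z. z \<in> {\<Phi> p |p. p \<in> elts S \<and> pfst p = x} \<Longrightarrow> z \<le> y"
    moreover have "\<psi> x \<in> {\<Phi> p |p. p \<in> elts S \<and> pfst p = x}"
      using that by (auto intro!: exI[of _ "pair x (enc \<T> (\<psi> x))"]
        simp: S_def \<Phi>_def prodset_simps elts_Vset dec_enc)
    ultimately show "\<psi> x \<le> y" by blast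
  qed (auto simp: \<Phi>_def)
  have "xiT \<T> X \<phi> t = xiT \<T> X (\<lambda>x. \<Phi> (?s x)) t"
    using le by (intro xiT_cong t) (simp add: \<Phi>_def pfst_pair psnd_pair dec_enc)
  also have "\<dots> = xiT \<T> S \<Phi> (TM \<T> X S ?s t)" by (rule xiT_comp[OF s t])
  also have "\<dots> \<le> shriek (TO \<T> S) (TM \<T> S X pfst) (xiT \<T> S \<Phi>) t"
    unfolding shriek_def
    using TM_comp[OF s f t] TM_id[OF t] TM_in[OF s t]
    by (intro Sup_upper CollectI exI[of _ "TM \<T> X S ?s t"]) (simp add: pfst_pair)
  also have "\<dots> = xiT \<T> X (shriek S pfst \<Phi>) t" by (rule xi_shriek[OF f t, symmetric])
  also have "\<dots> = xiT \<T> X \<psi> t" by (intro xiT_cong kan t)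
  finally show ?thesis .
qed

end

section \<open>Extending relations along the monad\<close>

context topological_theory
begin

lemma pfst_map: "pfst \<in> elts (prodset X Y) \<rightarrow> elts X"
  and psnd_map: "psnd \<in> elts (prodset X Y) \<rightarrow> elts Y"
  by (auto intro: pfst_closed psnd_closed)

lemma Txi_upper:
  "w \<in> elts (TO \<T> (prodset X Y)) \<Longrightarrow>
    xiT \<T> (prodset X Y) (\<lambda>p. r (pfst p) (psnd p)) w \<le>
    Txi \<T> X Y r (TM \<T> (prodset X Y) X pfst w) (TM \<T> (prodset X Y) Y psnd w)"
  unfolding Txi_def by (rule Sup_upper) blast

lemma Txi_least:
  "(\<And>w. w \<in> elts (TO \<T> (prodset X Y)) \<Longrightarrow> TM \<T> (prodset X Y) X pfst w = s \<Longrightarrow>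
      TM \<T> (prodset X Y) Y psnd w = t \<Longrightarrow>
      xiT \<T> (prodset X Y) (\<lambda>p. r (pfst p) (psnd p)) w \<le> u) \<Longrightarrow>
    Txi \<T> X Y r s t \<le> u"
  unfolding Txi_def by (rule Sup_least) blast

text \<open>
  Every span from \<open>X\<close> to \<open>Y\<close> factors through the product, so spans with any apex bound the
  extension from below.
\<close>

lemma Txi_span:
  assumes f: "f \<in> elts Z \<rightarrow> elts X" and g: "g \<in> elts Z \<rightarrow> elts Y" and t: "t \<in> elts (TO \<T> Z)"
  shows "xiT \<T> Z (\<lambda>z. r (f z) (g z)) t \<le> Txi \<T> X Y r (TM \<T> Z X f t) (TM \<T> Z Y g t)"
proof -
  let ?h = "\<lambda>z. pair (f z) (g z)" and ?P = "prodset X Y"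
  have h: "?h \<in> elts Z \<rightarrow> elts ?P" using f g by (auto simp: pair_in_prodset)
  have "xiT \<T> Z (\<lambda>z. r (f z) (g z)) t = xiT \<T> ?P (\<lambda>p. r (pfst p) (psnd p)) (TM \<T> Z ?P ?h t)"
    using xiT_comp[OF h t, of "\<lambda>p. r (pfst p) (psnd p)"] by (simp add: pfst_pair psnd_pair)
  also have "\<dots> \<le> Txi \<T> X Y r (TM \<T> ?P X pfst (TM \<T> Z ?P ?h t)) (TM \<T> ?P Y psnd (TM \<T> Z ?P ?h t))"
    by (rule Txi_upper) (rule TM_in[OF h t])
  also have "\<dots> = Txi \<T> X Y r (TM \<T> Z X f t) (TM \<T> Z Y g t)"
    using TM_comp[OF h pfst_map t] TM_comp[OF h psnd_map t] by (simp add: pfst_pair psnd_pair)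
  finally show ?thesis .
qed

lemma Txi_mono:
  assumes "\<And>x y. x \<in> elts X \<Longrightarrow> y \<in> elts Y \<Longrightarrow> r x y \<le> r' x y"
  shows "Txi \<T> X Y r s t \<le> Txi \<T> X Y r' s t"
proof (rule Txi_least)
  fix w assume w: "w \<in> elts (TO \<T> (prodset X Y))"
    "TM \<T> (prodset X Y) X pfst w = s" "TM \<T> (prodset X Y) Y psnd w = t"
  have "xiT \<T> (prodset X Y) (\<lambda>p. r (pfst p) (psnd p)) w \<le> xiT \<T> (prodset X Y) (\<lambda>p. r' (pfst p) (psnd p)) w"
    by (intro xiT_mono assms w pfst_closed psnd_closed)
  also have "\<dots> \<le> Txi \<T> X Y r' s t" using Txi_upper[OF w(1), of r'] w(2,3) by simp
  finally show "xiT \<T> (prodset X Y) (\<lambda>p. r (pfst p) (psnd p)) w \<le> Txi \<T> X Y r' s t" .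
qed

lemma Txi_cong:
  assumes "\<And>x y. x \<in> elts X \<Longrightarrow> y \<in> elts Y \<Longrightarrow> r x y = r' x y"
  shows "Txi \<T> X Y r s t = Txi \<T> X Y r' s t"
  by (rule antisym) (auto intro!: Txi_mono simp: assms)

lemma Txi_rconv: "Txi \<T> Y X (rconv r) t s = Txi \<T> X Y r s t"
proof -
  have le: "Txi \<T> X Y r s t \<le> Txi \<T> Y X (rconv r) t s" for X Y s t and r :: "'u \<Rightarrow> 'u \<Rightarrow> 'v"
  proof (rule Txi_least)
    fix w assume w: "w \<in> elts (TO \<T> (prodset X Y))"
      "TM \<T> (prodset X Y) X pfst w = s" "TM \<T> (prodset X Y) Y psnd w = t"
    show "xiT \<T> (prodset X Y) (\<lambda>p. r (pfst p) (psnd p)) w \<le> Txi \<T> Y X (rconv r) t s"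
      using Txi_span[OF psnd_map pfst_map w(1), where r = "rconv r"] w(2,3) by (simp add: rconv_def)
  qed
  have "rconv (rconv r) = r" by (intro ext) (simp add: rconv_def)
  then show ?thesis using le[of X Y r s t] le[of Y X "rconv r" t s] by simp
qed

text \<open>
  A relation that contains the graph of \<open>f\<close> extends to one that contains the graph of \<open>Tf\<close>, since
  the graph map \<open>x \<mapsto> (x, f x)\<close> gives a span over which the extension is the constant \<open>1\<close>.
\<close>

lemma Txi_total:
  assumes "f \<in> elts X \<rightarrow> elts Y" "\<And>x. x \<in> elts X \<Longrightarrow> 1 \<le> r x (f x)" "t \<in> elts (TO \<T> X)"
  shows "1 \<le> Txi \<T> X Y r t (TM \<T> X Y f t)"
proof -
  have "1 = xiT \<T> X (\<lambda>_. 1) t" using xiT_one[OF assms(3)] by simp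
  also have "\<dots> \<le> xiT \<T> X (\<lambda>x. r x (f x)) t" by (intro xiT_mono assms)
  also have "\<dots> \<le> Txi \<T> X Y r (TM \<T> X X (\<lambda>x. x) t) (TM \<T> X Y f t)"
    using assms by (intro Txi_span) auto
  finally show ?thesis by (simp add: TM_id assms)
qed

lemma Txi_refl:
  assumes "\<And>x. x \<in> elts X \<Longrightarrow> 1 \<le> r x x" "t \<in> elts (TO \<T> X)"
  shows "1 \<le> Txi \<T> X X r t t"
  using Txi_total[of "\<lambda>x. x" X X r t] assms by (simp add: TM_id)

lemma Txi_unit_lax:
  assumes "x \<in> elts X" "y \<in> elts Y"
  shows "r x y \<le> Txi \<T> X Y r (unit \<T> X x) (unit \<T> Y y)"
proof -
  let ?P = "prodset X Y" and ?p = "pair x y"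
  have p: "?p \<in> elts ?P" using assms by (simp add: pair_in_prodset)
  have "r x y = xiT \<T> ?P (\<lambda>p. r (pfst p) (psnd p)) (unit \<T> ?P ?p)"
    by (simp add: xiT_unit[OF p] pfst_pair psnd_pair)
  also have "\<dots> \<le> Txi \<T> X Y r (TM \<T> ?P X pfst (unit \<T> ?P ?p)) (TM \<T> ?P Y psnd (unit \<T> ?P ?p))"
    by (rule Txi_upper) (rule unit_in[OF p])
  finally show ?thesis
    by (simp add: unit_natural[OF pfst_map p] unit_natural[OF psnd_map p] pfst_pair psnd_pair)
qed

text \<open>
  The nontrivial inequality lifts an element of \<open>T(Y \<times> Z)\<close> to \<open>T(X \<times> Z)\<close>; this is possible because
  \<open>X \<times> Z\<close> is the pullback of \<open>f\<close> along the projection \<open>Y \<times> Z \<rightarrow> Y\<close>.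
\<close>

lemma Txi_comp_map:
  assumes f: "f \<in> elts X \<rightarrow> elts Y" and s: "s \<in> elts (TO \<T> X)"
  shows "Txi \<T> X Z (\<lambda>x z. r (f x) z) s t = Txi \<T> Y Z r (TM \<T> X Y f s) t"
proof (rule antisym)
  show "Txi \<T> X Z (\<lambda>x z. r (f x) z) s t \<le> Txi \<T> Y Z r (TM \<T> X Y f s) t"
  proof (rule Txi_least)
    fix w assume w: "w \<in> elts (TO \<T> (prodset X Z))"
      "TM \<T> (prodset X Z) X pfst w = s" "TM \<T> (prodset X Z) Z psnd w = t"
    have g: "(\<lambda>p. f (pfst p)) \<in> elts (prodset X Z) \<rightarrow> elts Y" using f by (auto simp: pfst_closed)
    show "xiT \<T> (prodset X Z) (\<lambda>p. r (f (pfst p)) (psnd p)) w \<le> Txi \<T> Y Z r (TM \<T> X Y f s) t"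
      using Txi_span[OF g psnd_map w(1), of r] TM_comp[OF pfst_map f w(1)] w(2,3) by simp
  qed
  show "Txi \<T> Y Z r (TM \<T> X Y f s) t \<le> Txi \<T> X Z (\<lambda>x z. r (f x) z) s t"
  proof (rule Txi_least)
    let ?g = "\<lambda>p. pair (f (pfst p)) (psnd p)"
    fix w assume w: "w \<in> elts (TO \<T> (prodset Y Z))"
      "TM \<T> (prodset Y Z) Y pfst w = TM \<T> X Y f s" "TM \<T> (prodset Y Z) Z psnd w = t"
    have g: "?g \<in> elts (prodset X Z) \<rightarrow> elts (prodset Y Z)"
      using f by (auto simp: prodset_simps)
    have "weak_pullback (prodset X Z) X (prodset Y Z) Y pfst ?g f pfst"
    proof (rule weak_pullbackI[OF pfst_map g f pfst_map])
      fix x y assume "x \<in> elts X" "y \<in> elts (prodset Y Z)" "f x = pfst y"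
      then show "\<exists>w\<in>elts (prodset X Z). pfst w = x \<and> ?g w = y"
        by (intro bexI[of _ "pair x (psnd y)"]) (simp_all add: prodset_simps)
    qed (simp add: pfst_pair)
    from weak_pullback_lift[OF T_weak_pullback[OF this] s w(1) w(2)[symmetric]]
    obtain v where v: "v \<in> elts (TO \<T> (prodset X Z))" "TM \<T> (prodset X Z) X pfst v = s"
      "TM \<T> (prodset X Z) (prodset Y Z) ?g v = w" by blast
    have "TM \<T> (prodset X Z) Z psnd v = t"
      using TM_comp[OF g psnd_map v(1)] w(3) v(3) by (simp add: psnd_pair)
    then show "xiT \<T> (prodset Y Z) (\<lambda>p. r (pfst p) (psnd p)) w \<le> Txi \<T> X Z (\<lambda>x z. r (f x) z) s t"
      using Txi_upper[OF v(1), of "\<lambda>x z. r (f x) z"] v(2)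
        xiT_comp[OF g v(1), of "\<lambda>p. r (pfst p) (psnd p)"] v(3)
      by (simp add: pfst_pair psnd_pair)
  qed
qed

lemma Txi_comp_map_right:
  assumes "f \<in> elts Z \<rightarrow> elts Y" "t \<in> elts (TO \<T> Z)"
  shows "Txi \<T> X Z (\<lambda>x z. r x (f z)) s t = Txi \<T> X Y r s (TM \<T> Z Y f t)"
  using Txi_comp_map[OF assms, of X "rconv r" s] Txi_rconv[of Y X r "TM \<T> Z Y f t" s]
    Txi_rconv[of Z X "\<lambda>x z. r x (f z)" t s]
  by (simp add: rconv_def[abs_def])

text \<open>
  A composite of relations is a left Kan extension along \<open>X \<times> Y \<times> Z \<rightarrow> X \<times> Z\<close>, and the triple
  product is the pullback of \<open>X \<times> Y\<close> and \<open>Y \<times> Z\<close> over \<open>Y\<close>.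
\<close>

lemma Txi_rcomp: "Txi \<T> X Z (rcomp Y s r) x z =
    (SUP y\<in>elts (TO \<T> Y). Txi \<T> X Y r x y * Txi \<T> Y Z s y z)"
proof (rule antisym)
  define P where "P = prodset (prodset X Y) Z"
  let ?xy = "\<lambda>p. pfst p" and ?yz = "\<lambda>p. pair (psnd (pfst p)) (psnd p)"
  let ?xz = "\<lambda>p. pair (pfst (pfst p)) (psnd p)"
  let ?x = "\<lambda>p. pfst (pfst p)" and ?y = "\<lambda>p. psnd (pfst p)" and ?z = "psnd"
  have xy: "?xy \<in> elts P \<rightarrow> elts (prodset X Y)" and yz: "?yz \<in> elts P \<rightarrow> elts (prodset Y Z)"
    and xz: "?xz \<in> elts P \<rightarrow> elts (prodset X Z)" and mx: "?x \<in> elts P \<rightarrow> elts X"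
    and my: "?y \<in> elts P \<rightarrow> elts Y" and mz: "?z \<in> elts P \<rightarrow> elts Z"
    by (auto simp: P_def elts_prodset pfst_pair psnd_pair pair_inject)
  let ?\<phi> = "\<lambda>p. r (?x p) (?y p) * s (?y p) (?z p)"
  have kan: "rcomp Y s r (pfst p) (psnd p) = shriek P ?xz ?\<phi> p" if p: "p \<in> elts (prodset X Z)" for p
  proof (rule antisym)
    show "rcomp Y s r (pfst p) (psnd p) \<le> shriek P ?xz ?\<phi> p"
      unfolding rcomp_def shriek_def
    proof (rule SUP_least, rule Sup_upper)
      fix y assume "y \<in> elts Y"
      then show "r (pfst p) y * s y (psnd p) \<in> {?\<phi> q |q. q \<in> elts P \<and> ?xz q = p}"
        using p by (intro CollectI exI[of _ "pair (pair (pfst p) y) (psnd p)"])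
          (simp add: P_def prodset_simps)
    qed
    show "shriek P ?xz ?\<phi> p \<le> rcomp Y s r (pfst p) (psnd p)"
      unfolding shriek_def
    proof (rule Sup_least)
      fix v assume "v \<in> {?\<phi> q |q. q \<in> elts P \<and> ?xz q = p}"
      then obtain q where q: "v = ?\<phi> q" "q \<in> elts P" "?xz q = p" by blast
      then have "pfst p = ?x q" "psnd p = ?z q" "?y q \<in> elts Y"
        using my by (auto simp: pfst_pair psnd_pair)
      then show "v \<le> rcomp Y s r (pfst p) (psnd p)"
        using q(1) rcomp_upper[of "?y q" Y r "?x q" s "?z q"] by simp
    qed
  qed
  show "Txi \<T> X Z (rcomp Y s r) x z \<le> (SUP y\<in>elts (TO \<T> Y). Txi \<T> X Y r x y * Txi \<T> Y Z s y z)"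
  proof (rule Txi_least)
    fix w assume w: "w \<in> elts (TO \<T> (prodset X Z))"
      "TM \<T> (prodset X Z) X pfst w = x" "TM \<T> (prodset X Z) Z psnd w = z"
    have "xiT \<T> (prodset X Z) (\<lambda>p. rcomp Y s r (pfst p) (psnd p)) w =
        xiT \<T> (prodset X Z) (shriek P ?xz ?\<phi>) w"
      by (intro xiT_cong kan w)
    also have "\<dots> = shriek (TO \<T> P) (TM \<T> P (prodset X Z) ?xz) (xiT \<T> P ?\<phi>) w"
      by (rule xi_shriek[OF xz w(1)])
    also have "\<dots> \<le> (SUP y\<in>elts (TO \<T> Y). Txi \<T> X Y r x y * Txi \<T> Y Z s y z)"
      unfolding shriek_def
    proof (rule Sup_least)
      fix v assume "v \<in> {xiT \<T> P ?\<phi> q |q. q \<in> elts (TO \<T> P) \<and> TM \<T> P (prodset X Z) ?xz q = w}"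
      then obtain q where q: "v = xiT \<T> P ?\<phi> q" "q \<in> elts (TO \<T> P)" "TM \<T> P (prodset X Z) ?xz q = w"
        by blast
      have x: "TM \<T> P X ?x q = x" and z: "TM \<T> P Z ?z q = z"
        using TM_comp[OF xz pfst_map q(2)] TM_comp[OF xz psnd_map q(2)] q(3) w(2,3)
        by (simp_all add: pfst_pair psnd_pair)
      have "v = xiT \<T> P (\<lambda>p. r (?x p) (?y p)) q * xiT \<T> P (\<lambda>p. s (?y p) (?z p)) q"
        using xiT_tensor[OF q(2)] q(1) by simp
      also have "\<dots> \<le> Txi \<T> X Y r x (TM \<T> P Y ?y q) * Txi \<T> Y Z s (TM \<T> P Y ?y q) z"
        using Txi_span[OF mx my q(2), of r] Txi_span[OF my mz q(2), of s] x z
        by (intro tensor_mono) simp_all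
      also have "\<dots> \<le> (SUP y\<in>elts (TO \<T> Y). Txi \<T> X Y r x y * Txi \<T> Y Z s y z)"
        by (rule SUP_upper) (rule TM_in[OF my q(2)])
      finally show "v \<le> (SUP y\<in>elts (TO \<T> Y). Txi \<T> X Y r x y * Txi \<T> Y Z s y z)" .
    qed
    finally show "xiT \<T> (prodset X Z) (\<lambda>p. rcomp Y s r (pfst p) (psnd p)) w
      \<le> (SUP y\<in>elts (TO \<T> Y). Txi \<T> X Y r x y * Txi \<T> Y Z s y z)" .
  qed
  have "weak_pullback P (prodset X Y) (prodset Y Z) Y ?xy ?yz psnd pfst"
  proof (rule weak_pullbackI[OF xy yz psnd_map pfst_map])
    fix u v assume "u \<in> elts (prodset X Y)" "v \<in> elts (prodset Y Z)" "psnd u = pfst v"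
    then show "\<exists>w\<in>elts P. ?xy w = u \<and> ?yz w = v"
      by (intro bexI[of _ "pair u (psnd v)"]) (simp_all add: P_def prodset_simps)
  qed (simp add: pfst_pair)
  note pb = T_weak_pullback[OF this]
  (* Elements of T(X \<times> Y) and T(Y \<times> Z) over the same element of TY glue to one of T(X \<times> Y \<times> Z). *)
  have le: "xiT \<T> (prodset X Y) (\<lambda>p. r (pfst p) (psnd p)) u * xiT \<T> (prodset Y Z) (\<lambda>p. s (pfst p) (psnd p)) v
      \<le> Txi \<T> X Z (rcomp Y s r) x z"
    if u: "u \<in> elts (TO \<T> (prodset X Y))" "TM \<T> (prodset X Y) X pfst u = x" "TM \<T> (prodset X Y) Y psnd u = y"
      and v: "v \<in> elts (TO \<T> (prodset Y Z))" "TM \<T> (prodset Y Z) Y pfst v = y" "TM \<T> (prodset Y Z) Z psnd v = z"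
    for u v y
  proof -
    have "TM \<T> (prodset X Y) Y psnd u = TM \<T> (prodset Y Z) Y pfst v" using u v by simp
    from weak_pullback_lift[OF pb u(1) v(1) this] obtain q where q: "q \<in> elts (TO \<T> P)"
      "TM \<T> P (prodset X Y) ?xy q = u" "TM \<T> P (prodset Y Z) ?yz q = v" by blast
    have x: "TM \<T> P X ?x q = x" and z: "TM \<T> P Z ?z q = z"
      using TM_comp[OF xy pfst_map q(1)] TM_comp[OF yz psnd_map q(1)] q(2,3) u(2) v(3)
      by (simp_all add: psnd_pair)
    have "xiT \<T> (prodset X Y) (\<lambda>p. r (pfst p) (psnd p)) u * xiT \<T> (prodset Y Z) (\<lambda>p. s (pfst p) (psnd p)) v
        = xiT \<T> P ?\<phi> q"
      using xiT_comp[OF xy q(1), of "\<lambda>p. r (pfst p) (psnd p)"] q(2,3)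
        xiT_comp[OF yz q(1), of "\<lambda>p. s (pfst p) (psnd p)"] xiT_tensor[OF q(1)]
      by (simp add: pfst_pair psnd_pair)
    also have "\<dots> \<le> xiT \<T> P (\<lambda>p. rcomp Y s r (?x p) (?z p)) q"
      using my by (intro xiT_mono q rcomp_upper) auto
    also have "\<dots> \<le> Txi \<T> X Z (rcomp Y s r) x z"
      using Txi_span[OF mx mz q(1), of "rcomp Y s r"] x z by simp
    finally show ?thesis .
  qed
  have "Txi \<T> X Y r x y * Txi \<T> Y Z s y z \<le> Txi \<T> X Z (rcomp Y s r) x z" for y
  proof -
    (* The residual turns the product into a bound on each factor, so that suprema are treated one at a time. *)
    have "Txi \<T> X Y r x y \<le> qhom (Txi \<T> Y Z s y z) (Txi \<T> X Z (rcomp Y s r) x z)"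
    proof (rule Txi_least)
      fix u assume u: "u \<in> elts (TO \<T> (prodset X Y))" "TM \<T> (prodset X Y) X pfst u = x"
        "TM \<T> (prodset X Y) Y psnd u = y"
      let ?u = "xiT \<T> (prodset X Y) (\<lambda>p. r (pfst p) (psnd p)) u"
      have "Txi \<T> Y Z s y z \<le> qhom ?u (Txi \<T> X Z (rcomp Y s r) x z)"
        using le[OF u] by (intro Txi_least) (simp add: qhom_adjunction[symmetric] mult.commute)
      then show "?u \<le> qhom (Txi \<T> Y Z s y z) (Txi \<T> X Z (rcomp Y s r) x z)"
        by (simp add: qhom_adjunction[symmetric] mult.commute)
    qed
    then show ?thesis by (simp add: qhom_adjunction[symmetric])
  qed
  then show "(SUP y\<in>elts (TO \<T> Y). Txi \<T> X Y r x y * Txi \<T> Y Z s y z) \<le> Txi \<T> X Z (rcomp Y s r) x z"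
    by (rule SUP_least)
qed

lemma Txi_rcomp_upper:
  "y \<in> elts (TO \<T> Y) \<Longrightarrow> Txi \<T> X Y r x y * Txi \<T> Y Z s y z \<le> Txi \<T> X Z (rcomp Y s r) x z"
  unfolding Txi_rcomp by (rule SUP_upper)

text \<open>
  The extended relation is itself a left Kan extension, along \<open>T(X \<times> Y) \<rightarrow> TX \<times> TY\<close>, so that it
  can be extended a second time.
\<close>

lemma Txi_mult_lax:
  "Txi \<T> (TO \<T> X) (TO \<T> Y) (Txi \<T> X Y r) s t \<le> Txi \<T> X Y r (mult \<T> X s) (mult \<T> Y t)"
proof (rule Txi_least)
  let ?P = "prodset X Y" and ?R = "\<lambda>p. r (pfst p) (psnd p)"
  let ?a = "TM \<T> ?P X pfst" and ?b = "TM \<T> ?P Y psnd"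
  let ?TT = "prodset (TO \<T> X) (TO \<T> Y)" and ?g = "\<lambda>w. pair (?a w) (?b w)"
  fix w assume w: "w \<in> elts (TO \<T> ?TT)" "TM \<T> ?TT (TO \<T> X) pfst w = s" "TM \<T> ?TT (TO \<T> Y) psnd w = t"
  have a: "?a \<in> elts (TO \<T> ?P) \<rightarrow> elts (TO \<T> X)" and b: "?b \<in> elts (TO \<T> ?P) \<rightarrow> elts (TO \<T> Y)"
    by (rule TM_closed pfst_map psnd_map)+
  then have g: "?g \<in> elts (TO \<T> ?P) \<rightarrow> elts ?TT" by (auto simp: pair_in_prodset)
  have kan: "Txi \<T> X Y r (pfst p) (psnd p) = shriek (TO \<T> ?P) ?g (xiT \<T> ?P ?R) p"
    if "p \<in> elts ?TT" for p
  proof -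
    have "?g v = p \<longleftrightarrow> ?a v = pfst p \<and> ?b v = psnd p" for v
      using pair_inject[of "?a v" "?b v" "pfst p" "psnd p"] pair_collapse[OF that] by simp
    then show ?thesis unfolding Txi_def shriek_def by simp
  qed
  have "xiT \<T> ?TT (\<lambda>p. Txi \<T> X Y r (pfst p) (psnd p)) w = xiT \<T> ?TT (shriek (TO \<T> ?P) ?g (xiT \<T> ?P ?R)) w"
    by (intro xiT_cong kan w)
  also have "\<dots> = shriek (TO \<T> (TO \<T> ?P)) (TM \<T> (TO \<T> ?P) ?TT ?g) (xiT \<T> (TO \<T> ?P) (xiT \<T> ?P ?R)) w"
    by (rule xi_shriek[OF g w(1)])
  also have "\<dots> \<le> Txi \<T> X Y r (mult \<T> X s) (mult \<T> Y t)"
    unfolding shriek_def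
  proof (rule Sup_least)
    fix u assume "u \<in> {xiT \<T> (TO \<T> ?P) (xiT \<T> ?P ?R) q |q.
      q \<in> elts (TO \<T> (TO \<T> ?P)) \<and> TM \<T> (TO \<T> ?P) ?TT ?g q = w}"
    then obtain q where q: "u = xiT \<T> (TO \<T> ?P) (xiT \<T> ?P ?R) q" "q \<in> elts (TO \<T> (TO \<T> ?P))"
      "TM \<T> (TO \<T> ?P) ?TT ?g q = w" by blast
    have "?a (mult \<T> ?P q) = mult \<T> X s" "?b (mult \<T> ?P q) = mult \<T> Y t"
      using mult_natural[OF pfst_map q(2)] mult_natural[OF psnd_map q(2)]
        TM_comp[OF g pfst_map q(2)] TM_comp[OF g psnd_map q(2)] q(3) w(2,3)
      by (simp_all add: pfst_pair psnd_pair)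
    then show "u \<le> Txi \<T> X Y r (mult \<T> X s) (mult \<T> Y t)"
      using Txi_upper[OF mult_in[OF q(2)], of r] xiT_mult[OF q(2), of ?R] q(1) by simp
  qed
  finally show "xiT \<T> ?TT (\<lambda>p. Txi \<T> X Y r (pfst p) (psnd p)) w
    \<le> Txi \<T> X Y r (mult \<T> X s) (mult \<T> Y t)" .
qed

text \<open>
  In the converse direction the first argument has to be lifted along the multiplication: an element of \<open>T(X \<times> Y)\<close>
  lying over \<open>mult t\<close> is itself of the form \<open>mult q\<close> with \<open>q\<close> over \<open>t\<close>, because the naturality square
  of the multiplication at the projection \<open>X \<times> Y \<rightarrow> Y\<close> is a weak pullback.
\<close>

lemma Txi_mult_oplax:
  assumes t: "t \<in> elts (TO \<T> (TO \<T> Y))"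
  shows "Txi \<T> X Y r s (mult \<T> Y t) \<le>
    (SUP v\<in>{v \<in> elts (TO \<T> (TO \<T> X)). mult \<T> X v = s}. Txi \<T> (TO \<T> X) (TO \<T> Y) (Txi \<T> X Y r) v t)"
proof (rule Txi_least)
  let ?P = "prodset X Y" and ?R = "\<lambda>p. r (pfst p) (psnd p)"
  let ?a = "TM \<T> ?P X pfst" and ?b = "TM \<T> ?P Y psnd"
  let ?Ta = "TM \<T> (TO \<T> ?P) (TO \<T> X) ?a" and ?Tb = "TM \<T> (TO \<T> ?P) (TO \<T> Y) ?b"
  fix w assume w: "w \<in> elts (TO \<T> ?P)" "?a w = s" "?b w = mult \<T> Y t"
  have a: "?a \<in> elts (TO \<T> ?P) \<rightarrow> elts (TO \<T> X)" and b: "?b \<in> elts (TO \<T> ?P) \<rightarrow> elts (TO \<T> Y)"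
    by (rule TM_closed pfst_map psnd_map)+
  from weak_pullback_lift[OF mult_weak_pullback[OF psnd_map] w(1) t w(3)]
  obtain q where q: "q \<in> elts (TO \<T> (TO \<T> ?P))" "mult \<T> ?P q = w" "?Tb q = t" by blast
  have "xiT \<T> ?P ?R w = xiT \<T> (TO \<T> ?P) (xiT \<T> ?P ?R) q" using xiT_mult[OF q(1)] q(2) by simp
  also have "\<dots> \<le> xiT \<T> (TO \<T> ?P) (\<lambda>w. Txi \<T> X Y r (?a w) (?b w)) q"
    by (intro xiT_mono Txi_upper q)
  also have "\<dots> \<le> Txi \<T> (TO \<T> X) (TO \<T> Y) (Txi \<T> X Y r) (?Ta q) t"
    using Txi_span[OF a b q(1), of "Txi \<T> X Y r"] q(3) by simp
  also have "\<dots> \<le> (SUP v\<in>{v \<in> elts (TO \<T> (TO \<T> X)). mult \<T> X v = s}.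
      Txi \<T> (TO \<T> X) (TO \<T> Y) (Txi \<T> X Y r) v t)"
    using mult_natural[OF pfst_map q(1)] q(2) w(2) TM_in[OF a q(1)] by (intro SUP_upper) simp
  finally show "xiT \<T> ?P ?R w \<le> (SUP v\<in>{v \<in> elts (TO \<T> (TO \<T> X)). mult \<T> X v = s}.
      Txi \<T> (TO \<T> X) (TO \<T> Y) (Txi \<T> X Y r) v t)" .
qed

lemma Txi_mult_oplax_right:
  assumes s: "s \<in> elts (TO \<T> (TO \<T> X))"
  shows "Txi \<T> X Y r (mult \<T> X s) t \<le>
    (SUP v\<in>{v \<in> elts (TO \<T> (TO \<T> Y)). mult \<T> Y v = t}. Txi \<T> (TO \<T> X) (TO \<T> Y) (Txi \<T> X Y r) s v)"
proof -
  have "Txi \<T> Y X (rconv r) = rconv (Txi \<T> X Y r)" for X Y and r :: "'u \<Rightarrow> 'u \<Rightarrow> 'v"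
    by (intro ext) (simp add: Txi_rconv rconv_def)
  then show ?thesis using Txi_mult_oplax[OF s, of Y "rconv r" t] by (simp add: rconv_def)
qed

text \<open>
  At a principal element the extension only depends on one row of the relation: the row \<open>{x} \<times> Y\<close>
  is the pullback of the point \<open>x\<close> along the projection \<open>X \<times> Y \<rightarrow> X\<close>. The converse inequality
  needs that \<open>T\<close> sends the constant map \<open>x\<close> to the constant map \<open>unit x\<close>, which holds as \<open>T1 = 1\<close>.
\<close>

lemma Txi_row_le:
  assumes x: "x \<in> elts X"
  shows "Txi \<T> X Y r (unit \<T> X x) t \<le> xiT \<T> Y (r x) t"
proof (rule Txi_least)
  let ?P = "prodset X Y"
  define pt where "pt = (set_of {} :: 'u)"
  fix w assume w: "w \<in> elts (TO \<T> ?P)" "TM \<T> ?P X pfst w = unit \<T> X x" "TM \<T> ?P Y psnd w = t"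
  have pt: "pt \<in> elts one" by (simp add: elts_one pt_def)
  have g: "pair x \<in> elts Y \<rightarrow> elts ?P" using x by (simp add: pair_in_prodset)
  have c: "(\<lambda>_. x) \<in> elts one \<rightarrow> elts X" using x by simp
  have "weak_pullback Y ?P one X (pair x) (\<lambda>_. pt) pfst (\<lambda>_. x)"
  proof (rule weak_pullbackI[OF g _ pfst_map c])
    fix u v :: 'u assume "u \<in> elts ?P" "v \<in> elts one" "pfst u = x"
    then show "\<exists>w\<in>elts Y. pair x w = u \<and> pt = v"
      by (intro bexI[of _ "psnd u"]) (auto simp: prodset_simps elts_one pt_def)
  qed (simp_all add: pt pfst_pair)
  note pb = T_weak_pullback[OF this]
  have "TM \<T> ?P X pfst w = TM \<T> one X (\<lambda>_. x) (unit \<T> one pt)"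
    using w(2) unit_natural[OF c pt] by simp
  from weak_pullback_lift[OF pb w(1) unit_in[OF pt] this]
  obtain v where v: "v \<in> elts (TO \<T> Y)" "TM \<T> Y ?P (pair x) v = w" by blast
  have "v = t" using TM_comp[OF g psnd_map v(1)] v(2) w(3) TM_id[OF v(1)] by (simp add: psnd_pair)
  then show "xiT \<T> ?P (\<lambda>p. r (pfst p) (psnd p)) w \<le> xiT \<T> Y (r x) t"
    using xiT_comp[OF g v(1), of "\<lambda>p. r (pfst p) (psnd p)"] v(2)
    by (simp add: pfst_pair psnd_pair)
qed

lemma Txi_row:
  assumes T1: "\<exists>t. elts (TO \<T> one) = {t}" and x: "x \<in> elts X" and t: "t \<in> elts (TO \<T> Y)"
  shows "Txi \<T> X Y r (unit \<T> X x) t = xiT \<T> Y (r x) t"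
proof (rule antisym[OF Txi_row_le[OF x]])
  let ?pt = "set_of {} :: 'u"
  have pt: "?pt \<in> elts one" by (simp add: elts_one)
  have c: "(\<lambda>_. x) \<in> elts one \<rightarrow> elts X" and k: "(\<lambda>_. ?pt) \<in> elts Y \<rightarrow> elts one"
    and cx: "(\<lambda>_. x) \<in> elts Y \<rightarrow> elts X"
    using x pt by auto
  have "TM \<T> Y one (\<lambda>_. ?pt) t = unit \<T> one ?pt"
    using T1 TM_in[OF k t] unit_in[OF pt] by auto
  then have "TM \<T> Y X (\<lambda>_. x) t = unit \<T> X x"
    using TM_comp[OF k c t] unit_natural[OF c pt] by simp
  then show "xiT \<T> Y (r x) t \<le> Txi \<T> X Y r (unit \<T> X x) t"
    using Txi_span[OF cx _ t, of "\<lambda>y. y" Y r] TM_id[OF t] by simp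
qed

end


section \<open>The hat construction\<close>

context topological_theory
begin

text \<open>
  The graph of \<open>f\<close> is the left Kan extension of the constant \<open>1\<close> along \<open>x \<mapsto> (x, f x)\<close>, and constants
  with value \<open>1\<close> are preserved; so the extension of a graph is bounded by the graph of \<open>Tf\<close>.
\<close>

lemma Txi_rmap_le:
  assumes f: "f \<in> elts X \<rightarrow> elts Y"
  shows "Txi \<T> X Y (rmap f) s t \<le> rmap (TM \<T> X Y f) s t"
proof (rule Txi_least)
  let ?P = "prodset X Y" and ?g = "\<lambda>x. pair x (f x)"
  fix w assume w: "w \<in> elts (TO \<T> ?P)" "TM \<T> ?P X pfst w = s" "TM \<T> ?P Y psnd w = t"
  have g: "?g \<in> elts X \<rightarrow> elts ?P" using f by (auto simp: pair_in_prodset)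
  have kan: "rmap f (pfst p) (psnd p) \<le> shriek X ?g (\<lambda>_. 1 :: 'v) p" if "p \<in> elts ?P" for p
    using that unfolding shriek_def
    by (auto simp: rmap_def elts_prodset pair_inject pfst_pair psnd_pair intro!: Sup_upper)
  have "xiT \<T> ?P (\<lambda>p. rmap f (pfst p) (psnd p)) w \<le> xiT \<T> ?P (shriek X ?g (\<lambda>_. 1)) w"
    by (intro xiT_mono kan w)
  also have "\<dots> = shriek (TO \<T> X) (TM \<T> X ?P ?g) (xiT \<T> X (\<lambda>_. 1)) w"
    by (rule xi_shriek[OF g w(1)])
  also have "\<dots> \<le> rmap (TM \<T> X Y f) s t"
    unfolding shriek_def
  proof (rule Sup_least)
    fix v assume "v \<in> {xiT \<T> X (\<lambda>_. 1) q |q. q \<in> elts (TO \<T> X) \<and> TM \<T> X ?P ?g q = w}"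
    then obtain q where q: "v = 1" "q \<in> elts (TO \<T> X)" "TM \<T> X ?P ?g q = w"
      by (auto simp: xiT_one)
    have "s = q" "t = TM \<T> X Y f q"
      using TM_comp[OF g pfst_map q(2)] TM_comp[OF g psnd_map q(2)] q w TM_id[OF q(2)]
      by (simp_all add: pfst_pair psnd_pair)
    then show "v \<le> rmap (TM \<T> X Y f) s t" by (simp add: rmap_def q(1))
  qed
  finally show "xiT \<T> ?P (\<lambda>p. rmap f (pfst p) (psnd p)) w \<le> rmap (TM \<T> X Y f) s t" .
qed

lemma hat_upper:
  assumes "w \<in> elts (TO \<T> (TO \<T> (obj A)))"
  shows "Txi \<T> (TO \<T> (obj A)) (obj A) (str A) w t \<le> hat \<T> A (mult \<T> (obj A) w) t"
  using rcomp_upper[OF assms, of "rconv (rmap (mult \<T> (obj A)))" "mult \<T> (obj A) w"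
      "Txi \<T> (TO \<T> (obj A)) (obj A) (str A)" t]
  by (simp add: hat_def rconv_def rmap_def)

lemma hat_least:
  assumes "\<And>w. w \<in> elts (TO \<T> (TO \<T> (obj A))) \<Longrightarrow> mult \<T> (obj A) w = s \<Longrightarrow>
    Txi \<T> (TO \<T> (obj A)) (obj A) (str A) w t \<le> u"
  shows "hat \<T> A s t \<le> u"
  unfolding hat_def rcomp_def
  by (rule SUP_least) (auto simp: rconv_def rmap_def bot_tensor assms)

lemma str0_eq: "x \<in> elts (obj A) \<Longrightarrow> str0 \<T> A x y = str A (unit \<T> (obj A) x) y"
  by (simp add: str0_def rcomp_rmap unit_in)

lemma Txi_str0_le_hat:
  assumes "s \<in> elts (TO \<T> (obj A))"
  shows "Txi \<T> (obj A) (obj A) (str0 \<T> A) s t \<le> hat \<T> A s t"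
proof -
  have "Txi \<T> (obj A) (obj A) (str0 \<T> A) s t =
      Txi \<T> (obj A) (obj A) (\<lambda>x y. str A (unit \<T> (obj A) x) y) s t"
    by (rule Txi_cong) (rule str0_eq)
  also have "\<dots> = Txi \<T> (TO \<T> (obj A)) (obj A) (str A)
      (TM \<T> (obj A) (TO \<T> (obj A)) (unit \<T> (obj A)) s) t"
    by (rule Txi_comp_map[OF unit_closed assms])
  also have "\<dots> \<le> hat \<T> A s t"
    using hat_upper[OF TM_in[OF unit_closed assms], of t] mult_T_unit[OF assms] by simp
  finally show ?thesis .
qed

lemma str_le_hat:
  assumes "s \<in> elts (TO \<T> (obj A))" "x \<in> elts (obj A)"
  shows "str A s x \<le> hat \<T> A s (unit \<T> (obj A) x)"
  using Txi_unit_lax[OF assms, of "str A"] hat_upper[OF unit_in[OF assms(1)]] mult_unit[OF assms(1)]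
  by (metis order_trans)

lemma tcategory_refl: "tcategory \<T> A \<Longrightarrow> x \<in> elts (obj A) \<Longrightarrow> 1 \<le> str A (unit \<T> (obj A) x) x"
  using unit_in[of x "obj A"] by (fastforce simp: tcategory_def rel_le_def rconv_def rmap_def)

lemma tcategory_trans:
  assumes "tcategory \<T> A" "s \<in> elts (TO \<T> (obj A))" "t \<in> elts (TO \<T> (obj A))" "x \<in> elts (obj A)"
  shows "hat \<T> A s t * str A t x \<le> str A s x"
  using assms rcomp_upper[OF assms(3), of "hat \<T> A" s "str A" x]
  unfolding tcategory_def rel_le_def by (meson order_trans)

lemma tcategory_trans_mult:
  assumes "tcategory \<T> A" "w \<in> elts (TO \<T> (TO \<T> (obj A)))" "t \<in> elts (TO \<T> (obj A))"
    "x \<in> elts (obj A)"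
  shows "Txi \<T> (TO \<T> (obj A)) (obj A) (str A) w t * str A t x \<le> str A (mult \<T> (obj A) w) x"
  using tensor_mono[OF hat_upper[OF assms(2)] order_refl]
    tcategory_trans[OF assms(1) mult_in[OF assms(2)] assms(3,4)]
  by (rule order_trans)

lemma hat_refl: "tcategory \<T> A \<Longrightarrow> t \<in> elts (TO \<T> (obj A)) \<Longrightarrow> 1 \<le> hat \<T> A t t"
  by (rule order_trans[OF Txi_refl Txi_str0_le_hat]) (auto simp: str0_eq tcategory_refl)

text \<open>
  As relations, \<open>Ta \<cdot> m\<degree> \<cdot> Ta \<cdot> m\<degree> \<le> Ta \<cdot> TTa \<cdot> m\<degree> \<cdot> m\<degree> = T(a \<cdot> Ta) \<cdot> (Tm)\<degree> \<cdot> m\<degree> \<le> Ta \<cdot> m\<degree>\<close>: the first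
  step lifts along the multiplication (\<open>Txi_mult_oplax\<close>), the last is transitivity of \<open>a\<close>.
\<close>

lemma hat_trans:
  assumes A: "tcategory \<T> A" and s: "s \<in> elts (TO \<T> (obj A))"
  shows "hat \<T> A s t * hat \<T> A t u \<le> hat \<T> A s u"
proof -
  let ?X = "obj A"
  let ?TX = "TO \<T> ?X"
  let ?TTX = "TO \<T> ?TX"
  let ?a = "Txi \<T> ?TX ?X (str A)"
  let ?aa = "Txi \<T> ?TTX ?TX ?a"
  have "hat \<T> A t u \<le> qhom (hat \<T> A s t) (hat \<T> A s u)"
  proof (rule hat_least)
    fix v assume v: "v \<in> elts ?TTX" "mult \<T> ?X v = t"
    have "hat \<T> A s t \<le> qhom (?a v u) (hat \<T> A s u)"
    proof (rule hat_least)
      fix w assume w: "w \<in> elts ?TTX" "mult \<T> ?X w = s"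
      have "?a w t \<le> (SUP W\<in>{W \<in> elts (TO \<T> ?TTX). mult \<T> ?TX W = w}. ?aa W v)"
        using Txi_mult_oplax[OF v(1), of ?TX "str A" w] v(2) by simp
      also have "\<dots> \<le> qhom (?a v u) (hat \<T> A s u)"
      proof (rule SUP_least)
        fix W assume "W \<in> {W \<in> elts (TO \<T> ?TTX). mult \<T> ?TX W = w}"
        then have W: "W \<in> elts (TO \<T> ?TTX)" "mult \<T> ?TX W = w" by auto
        let ?Tm = "TM \<T> ?TTX ?TX (mult \<T> ?X)"
        have "?aa W v * ?a v u \<le> Txi \<T> ?TTX ?X (rcomp ?TX (str A) ?a) W u"
          by (rule Txi_rcomp_upper[OF v(1)])
        also have "\<dots> \<le> Txi \<T> ?TTX ?X (\<lambda>w x. str A (mult \<T> ?X w) x) W u"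
          by (intro Txi_mono) (auto simp: rcomp_def intro!: SUP_least tcategory_trans_mult A)
        also have "\<dots> = ?a (?Tm W) u" by (rule Txi_comp_map[OF mult_closed W(1)])
        also have "\<dots> \<le> hat \<T> A s u"
          using hat_upper[OF TM_in[OF mult_closed W(1)], of u] mult_assoc[OF W(1)] W(2) w(2) by simp
        finally show "?aa W v \<le> qhom (?a v u) (hat \<T> A s u)" by (simp add: qhom_adjunction[symmetric])
      qed
      finally show "?a w t \<le> qhom (?a v u) (hat \<T> A s u)" .
    qed
    then show "?a v u \<le> qhom (hat \<T> A s t) (hat \<T> A s u)"
      by (simp add: qhom_adjunction[symmetric] mult.commute)
  qed
  then show ?thesis by (simp add: qhom_adjunction[symmetric] mult.commute)
qed

text \<open>
  As relations, \<open>m \<cdot> T(Ta \<cdot> m\<degree>) = m \<cdot> TTa \<cdot> (Tm)\<degree> \<le> Ta \<cdot> m \<cdot> (Tm)\<degree> \<le> Ta \<cdot> m\<degree> \<cdot> m\<close>, by associativity of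
  the multiplication in the last step.
\<close>

lemma hat_mult:
  assumes s: "s \<in> elts (TO \<T> (TO \<T> (obj A)))"
  shows "Txi \<T> (TO \<T> (obj A)) (TO \<T> (obj A)) (hat \<T> A) s t
    \<le> hat \<T> A (mult \<T> (obj A) s) (mult \<T> (obj A) t)"
proof -
  let ?X = "obj A"
  let ?TX = "TO \<T> ?X"
  let ?TTX = "TO \<T> ?TX"
  let ?a = "Txi \<T> ?TX ?X (str A)"
  let ?m = "mult \<T> ?X"
  show ?thesis
    unfolding hat_def[of \<T> A, THEN arg_cong, of "\<lambda>h. Txi \<T> ?TX ?TX h s t"] Txi_rcomp
  proof (rule SUP_least)
    fix W assume W: "W \<in> elts (TO \<T> ?TTX)"
    have "Txi \<T> ?TX ?TTX (rconv (rmap ?m)) s W \<le> rmap (TM \<T> ?TTX ?TX ?m) W s"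
      unfolding Txi_rconv by (rule Txi_rmap_le[OF mult_closed])
    moreover have "Txi \<T> ?TTX ?TX ?a W t \<le> hat \<T> A (?m (TM \<T> ?TTX ?TX ?m W)) (?m t)"
      using Txi_mult_lax[of ?TX ?X "str A" W t] hat_upper[OF mult_in[OF W], of "?m t"] mult_assoc[OF W]
      by simp
    ultimately have "Txi \<T> ?TX ?TTX (rconv (rmap ?m)) s W * Txi \<T> ?TTX ?TX ?a W t
        \<le> rmap (TM \<T> ?TTX ?TX ?m) W s * hat \<T> A (?m (TM \<T> ?TTX ?TX ?m W)) (?m t)"
      by (rule tensor_mono)
    then show "Txi \<T> ?TX ?TTX (rconv (rmap ?m)) s W * Txi \<T> ?TTX ?TX ?a W t \<le> hat \<T> A (?m s) (?m t)"
      by (auto simp: rmap_def bot_tensor split: if_splits intro: order_trans[OF _ bot_least])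
  qed
qed

lemma obj_Tcat: "obj (Tcat \<T> A) = TO \<T> (obj A)"
  by (simp add: Tcat_def)

lemma str_Tcat:
  "w \<in> elts (TO \<T> (TO \<T> (obj A))) \<Longrightarrow> str (Tcat \<T> A) w t = hat \<T> A (mult \<T> (obj A) w) t"
  by (simp add: Tcat_def rcomp_rmap mult_in)

lemma str0_Tcat: "s \<in> elts (TO \<T> (obj A)) \<Longrightarrow> str0 \<T> (Tcat \<T> A) s t = hat \<T> A s t"
  by (simp add: str0_eq obj_Tcat str_Tcat unit_in mult_unit)

end

section \<open>Representable categories as ordered pseudo-algebras\<close>

text \<open>
  The notion of representability that is used throughout: an ordered pseudo-algebra \<open>(r, \<alpha>)\<close> that
  presents the structure as \<open>r \<cdot> \<alpha>\<close>. All conditions are symmetric in \<open>r\<close>, except the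
  last, so that dualising is just reversal of \<open>r\<close>. The order and the algebra are
  parameters, not the canonical choices \<open>str0\<close> and \<open>rep_map\<close>, because the categories below have
  more convenient ones.
\<close>

locale algebra_presentation = topological_theory \<T>
  for \<T> :: "('u::grothendieck_universe, 'v::comm_quantale) ttheory" +
  fixes A :: "('u, 'v) tcat"
    and r :: "'u \<Rightarrow> 'u \<Rightarrow> 'v"
    and \<alpha> :: "'u \<Rightarrow> 'u"
  assumes alg_map: "\<alpha> \<in> elts (TO \<T> (obj A)) \<rightarrow> elts (obj A)"
    and refl: "x \<in> elts (obj A) \<Longrightarrow> 1 \<le> r x x"
    and trans: "\<lbrakk>x \<in> elts (obj A); y \<in> elts (obj A); z \<in> elts (obj A)\<rbrakk>
      \<Longrightarrow> r x y * r y z \<le> r x z"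
    and alg_mono: "\<lbrakk>s \<in> elts (TO \<T> (obj A)); t \<in> elts (TO \<T> (obj A))\<rbrakk>
      \<Longrightarrow> Txi \<T> (obj A) (obj A) r s t \<le> r (\<alpha> s) (\<alpha> t)"
    and alg_unit: "x \<in> elts (obj A) \<Longrightarrow> 1 \<le> r (\<alpha> (unit \<T> (obj A) x)) x"
      "x \<in> elts (obj A) \<Longrightarrow> 1 \<le> r x (\<alpha> (unit \<T> (obj A) x))"
    and alg_mult: "w \<in> elts (TO \<T> (TO \<T> (obj A))) \<Longrightarrow>
        1 \<le> r (\<alpha> (mult \<T> (obj A) w)) (\<alpha> (TM \<T> (TO \<T> (obj A)) (obj A) \<alpha> w))"
      "w \<in> elts (TO \<T> (TO \<T> (obj A))) \<Longrightarrow>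
        1 \<le> r (\<alpha> (TM \<T> (TO \<T> (obj A)) (obj A) \<alpha> w)) (\<alpha> (mult \<T> (obj A) w))"
    and str_eq: "\<lbrakk>t \<in> elts (TO \<T> (obj A)); x \<in> elts (obj A)\<rbrakk> \<Longrightarrow> str A t x = r (\<alpha> t) x"
begin

abbreviation "X \<equiv> obj A"
abbreviation "TX \<equiv> TO \<T> X"
abbreviation "T\<alpha> \<equiv> TM \<T> TX X \<alpha>"

lemma alg_in: "t \<in> elts TX \<Longrightarrow> \<alpha> t \<in> elts X"
  using alg_map by auto

lemma Talg_in: "w \<in> elts (TO \<T> TX) \<Longrightarrow> T\<alpha> w \<in> elts TX"
  by (rule TM_in[OF alg_map])

lemmas closed = alg_in Talg_in unit_in mult_in

lemma le_trans_left: "1 \<le> r x y \<Longrightarrow> x \<in> elts X \<Longrightarrow> y \<in> elts X \<Longrightarrow> z \<in> elts X \<Longrightarrow> r y z \<le> r x z"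
  by (rule tensor_le_if_le[OF _ trans])

lemma le_trans_right: "1 \<le> r y z \<Longrightarrow> x \<in> elts X \<Longrightarrow> y \<in> elts X \<Longrightarrow> z \<in> elts X \<Longrightarrow> r x y \<le> r x z"
  using tensor_le_if_le[of "r y z" "r x y" "r x z"] trans[of x y z] by (simp add: mult.commute)

lemma le_trans:
  "1 \<le> r x y \<Longrightarrow> 1 \<le> r y z \<Longrightarrow> x \<in> elts X \<Longrightarrow> y \<in> elts X \<Longrightarrow> z \<in> elts X \<Longrightarrow> 1 \<le> r x z"
  using le_trans_left order_trans by blast

lemma Txi_str:
  assumes "w \<in> elts (TO \<T> TX)"
  shows "Txi \<T> TX X (str A) w t = Txi \<T> X X r (T\<alpha> w) t"
  using Txi_cong[of TX X "str A" "\<lambda>t x. r (\<alpha> t) x" w t] Txi_comp_map[OF alg_map assms, of X r t]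
  by (simp add: str_eq)

lemma hat_le:
  assumes s: "s \<in> elts TX" and t: "t \<in> elts TX"
  shows "hat \<T> A s t \<le> r (\<alpha> s) (\<alpha> t)"
proof (rule hat_least)
  fix w assume w: "w \<in> elts (TO \<T> TX)" "mult \<T> X w = s"
  have "Txi \<T> TX X (str A) w t \<le> r (\<alpha> (T\<alpha> w)) (\<alpha> t)"
    using alg_mono[OF Talg_in[OF w(1)] t] by (simp add: Txi_str w(1))
  also have "\<dots> \<le> r (\<alpha> s) (\<alpha> t)"
    using alg_mult(1)[OF w(1)] w s t by (intro le_trans_left closed) auto
  finally show "Txi \<T> TX X (str A) w t \<le> r (\<alpha> s) (\<alpha> t)" .
qed

lemma str0_order: "x \<in> elts X \<Longrightarrow> y \<in> elts X \<Longrightarrow> str0 \<T> A x y = r x y"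
  by (auto simp: str0_eq str_eq unit_in intro!: antisym le_trans_left alg_unit closed)

lemma tcategory: "tcategory \<T> A"
proof -
  have "hat \<T> A s t * str A t x \<le> str A s x"
    if "s \<in> elts TX" "t \<in> elts TX" "x \<in> elts X" for s t x
    using tensor_mono[OF hat_le[OF that(1,2)] order_refl] trans[of "\<alpha> s" "\<alpha> t" x] that
    by (auto simp: str_eq alg_in intro: order_trans)
  then show ?thesis
    unfolding tcategory_def rel_le_def
    by (auto simp: rconv_def rmap_def rcomp_def str_eq closed alg_unit intro!: SUP_least)
qed

text \<open>
  With the structure \<open>r \<cdot> \<alpha>\<close> the hat relation is bounded by \<open>r (\<alpha> s) (\<alpha> t)\<close>, which makes \<open>\<alpha>\<close> a
  functor; it is bounded below by \<open>str\<close> at principal elements, which gives the unit of the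
  adjunction as reflexivity at \<open>\<alpha> t\<close>.
\<close>

lemma unit_adjoint: "adjoint \<T> (Tcat \<T> A) A \<alpha> (unit \<T> X)"
  unfolding adjoint_def tfunctor_def map_le_def
proof (intro conjI ballI)
  fix w t assume w: "w \<in> elts (TO \<T> (obj (Tcat \<T> A)))" and t: "t \<in> elts (obj (Tcat \<T> A))"
  have "hat \<T> A (mult \<T> X w) t \<le> r (\<alpha> (mult \<T> X w)) (\<alpha> t)"
    using w t by (intro hat_le closed) (simp_all add: obj_Tcat)
  also have "\<dots> \<le> r (\<alpha> (T\<alpha> w)) (\<alpha> t)"
    using w t by (intro le_trans_left alg_mult closed) (simp_all add: obj_Tcat)
  finally show "str (Tcat \<T> A) w t \<le> str A (TM \<T> (obj (Tcat \<T> A)) X \<alpha> w) (\<alpha> t)"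
    using w t by (simp add: obj_Tcat str_Tcat str_eq closed)
next
  fix t x assume t: "t \<in> elts TX" and x: "x \<in> elts X"
  then show "str A t x \<le> str (Tcat \<T> A) (TM \<T> X (obj (Tcat \<T> A)) (unit \<T> X) t) (unit \<T> X x)"
    using str_le_hat[OF t x] TM_in[OF unit_closed t] by (simp add: obj_Tcat str_Tcat mult_T_unit)
next
  fix t assume "t \<in> elts (obj (Tcat \<T> A))"
  then have t: "t \<in> elts TX" by (simp add: obj_Tcat)
  have "1 \<le> str A t (\<alpha> t)" using t by (simp add: str_eq closed refl)
  also have "\<dots> \<le> hat \<T> A t (unit \<T> X (\<alpha> t))" by (intro str_le_hat closed t)
  finally show "1 \<le> str0 \<T> (Tcat \<T> A) t (unit \<T> X (\<alpha> t))" by (simp add: str0_Tcat t)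
qed (auto simp: obj_Tcat alg_in unit_in str0_order alg_unit)

lemma representable: "representable \<T> A"
  unfolding representable_def using tcategory unit_adjoint by blast

end

context topological_theory
begin

text \<open>
  Conversely, functoriality of \<open>\<alpha>\<close> at principal elements says that \<open>\<alpha>\<close> is monotone from the hat
  relation to \<open>str0\<close>. Combined with the unit and the counit of the adjunction this identifies the
  structure with \<open>str0 \<cdot> \<alpha>\<close>. The two halves of the associativity law follow because in the hat
  relation \<open>mult w\<close> lies below \<open>T\<alpha> w\<close>, and because \<open>\<alpha>\<close> is a functor at \<open>w\<close> itself.
\<close>

lemma representable_presentation:
  assumes "representable \<T> A"
  shows "algebra_presentation \<T> A (str0 \<T> A) (rep_map \<T> A)"
proof -
  let ?X = "obj A"
  let ?TX = "TO \<T> ?X"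
  let ?e = "unit \<T> ?X" and ?m = "mult \<T> ?X"
  let ?r = "str0 \<T> A"
  define \<alpha> where "\<alpha> = rep_map \<T> A"
  let ?Ta = "TM \<T> ?TX ?X \<alpha>"
  have A: "tcategory \<T> A" using assms by (simp add: representable_def)
  have "adjoint \<T> (Tcat \<T> A) A \<alpha> ?e"
    unfolding \<alpha>_def rep_map_def
    using assms someI_ex[of "\<lambda>\<alpha>. adjoint \<T> (Tcat \<T> A) A \<alpha> ?e"] by (simp add: representable_def)
  then have a: "\<alpha> \<in> elts ?TX \<rightarrow> elts ?X"
    and fun_a: "\<And>w t. w \<in> elts (TO \<T> ?TX) \<Longrightarrow> t \<in> elts ?TX \<Longrightarrow> hat \<T> A (?m w) t \<le> str A (?Ta w) (\<alpha> t)"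
    and adj_unit: "\<And>t. t \<in> elts ?TX \<Longrightarrow> 1 \<le> hat \<T> A t (?e (\<alpha> t))"
    and adj_counit: "\<And>x. x \<in> elts ?X \<Longrightarrow> 1 \<le> ?r (\<alpha> (?e x)) x"
    by (auto simp: adjoint_def tfunctor_def map_le_def obj_Tcat str_Tcat str0_Tcat)
  have ain: "\<alpha> t \<in> elts ?X" if "t \<in> elts ?TX" for t using a that by auto
  have Tain: "?Ta w \<in> elts ?TX" if "w \<in> elts (TO \<T> ?TX)" for w by (rule TM_in[OF a that])
  note cl = ain Tain unit_in mult_in
  have refl: "1 \<le> ?r x x" if "x \<in> elts ?X" for x
    using that A by (simp add: str0_eq tcategory_refl)
  have trans: "?r x y * ?r y z \<le> ?r x z" if "x \<in> elts ?X" "y \<in> elts ?X" "z \<in> elts ?X" for x y z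
  proof -
    have "?r x y * ?r y z \<le> hat \<T> A (?e x) (?e y) * str A (?e y) z"
      using that by (intro tensor_mono) (simp_all add: str0_eq str_le_hat unit_in)
    also have "\<dots> \<le> ?r x z"
      using that tcategory_trans[OF A] by (simp add: str0_eq unit_in)
    finally show ?thesis .
  qed
  have le_trans_right: "?r x y \<le> ?r x z"
    if "1 \<le> ?r y z" "x \<in> elts ?X" "y \<in> elts ?X" "z \<in> elts ?X" for x y z
    using that tensor_le_if_le[of "?r y z" "?r x y" "?r x z"] trans[of x y z] by (simp add: mult.commute)
  have hat_le: "hat \<T> A s t \<le> ?r (\<alpha> s) (\<alpha> t)" if "s \<in> elts ?TX" "t \<in> elts ?TX" for s t
    using fun_a[OF unit_in[OF that(1)] that(2)] that
    by (simp add: mult_unit unit_natural[OF a] str0_eq ain)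
  have str: "str A s x = ?r (\<alpha> s) x" if s: "s \<in> elts ?TX" and x: "x \<in> elts ?X" for s x
  proof (rule antisym)
    have "str A s x \<le> hat \<T> A s (?e x)" by (rule str_le_hat[OF s x])
    also have "\<dots> \<le> ?r (\<alpha> s) (\<alpha> (?e x))" by (intro hat_le cl s x)
    also have "\<dots> \<le> ?r (\<alpha> s) x" by (intro le_trans_right adj_counit cl s x)
    finally show "str A s x \<le> ?r (\<alpha> s) x" .
    show "?r (\<alpha> s) x \<le> str A s x"
      unfolding str0_eq[OF ain[OF s]]
      by (rule tensor_le_if_le[OF adj_unit[OF s] tcategory_trans[OF A]]) (intro cl s x)+
  qed
  have Txi_le: "Txi \<T> ?X ?X ?r s t \<le> ?r (\<alpha> s) (\<alpha> t)" if "s \<in> elts ?TX" "t \<in> elts ?TX" for s t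
    using Txi_str0_le_hat[OF that(1)] hat_le[OF that] by (rule order_trans)
  have unit1: "1 \<le> ?r x (\<alpha> (?e x))" if x: "x \<in> elts ?X" for x
    using str[OF unit_in[OF x] ain[OF unit_in[OF x]]] refl[OF ain[OF unit_in[OF x]]]
    by (simp add: str0_eq x)
  have mult1: "1 \<le> ?r (\<alpha> (?m w)) (\<alpha> (?Ta w))" if w: "w \<in> elts (TO \<T> ?TX)" for w
  proof -
    have "1 \<le> Txi \<T> ?TX ?X (str A) w (?Ta w)"
      by (rule Txi_total[OF a _ w]) (simp add: str refl cl)
    also have "\<dots> \<le> hat \<T> A (?m w) (?Ta w)" by (rule hat_upper[OF w])
    also have "\<dots> \<le> ?r (\<alpha> (?m w)) (\<alpha> (?Ta w))" by (intro hat_le cl w)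
    finally show ?thesis .
  qed
  have mult2: "1 \<le> ?r (\<alpha> (?Ta w)) (\<alpha> (?m w))" if w: "w \<in> elts (TO \<T> ?TX)" for w
    using order_trans[OF hat_refl[OF A mult_in[OF w]] fun_a[OF w mult_in[OF w]]] w
    by (simp add: str cl)
  have "algebra_presentation_axioms \<T> A ?r \<alpha>"
    by (rule algebra_presentation_axioms.intro)
      (fact a refl trans Txi_le adj_counit unit1 mult1 mult2 str)+
  then show ?thesis unfolding \<alpha>_def by (intro algebra_presentation.intro topological_theory_axioms)
qed

lemma Tcat_presentation:
  assumes A: "tcategory \<T> A"
  shows "algebra_presentation \<T> (Tcat \<T> A) (hat \<T> A) (mult \<T> (obj A))"
  by unfold_locales
    (simp_all add: obj_Tcat str_Tcat hat_refl[OF A] hat_trans[OF A] hat_mult mult_in mult_unit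
      mult_assoc TM_in mult_closed del: Pi_iff)

end

section \<open>Functors between representable categories\<close>

context topological_theory
begin

lemma tfunctor_comp:
  assumes f: "tfunctor \<T> A B f" and g: "tfunctor \<T> B C g"
  shows "tfunctor \<T> A C (\<lambda>x. g (f x))"
proof -
  have fm: "f \<in> elts (obj A) \<rightarrow> elts (obj B)" and gm: "g \<in> elts (obj B) \<rightarrow> elts (obj C)"
    using f g by (simp_all add: tfunctor_def)
  have "str A t x \<le> str C (TM \<T> (obj A) (obj C) (\<lambda>x. g (f x)) t) (g (f x))"
    if t: "t \<in> elts (TO \<T> (obj A))" and x: "x \<in> elts (obj A)" for t x
  proof -
    have "str A t x \<le> str B (TM \<T> (obj A) (obj B) f t) (f x)" using f t x by (simp add: tfunctor_def)
    also have "\<dots> \<le> str C (TM \<T> (obj B) (obj C) g (TM \<T> (obj A) (obj B) f t)) (g (f x))"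
      using g TM_in[OF fm t] fm x by (auto simp: tfunctor_def)
    finally show ?thesis by (simp add: TM_comp[OF fm gm t])
  qed
  then show ?thesis using fm gm by (auto simp: tfunctor_def)
qed

lemma tfunctor_cong:
  assumes "\<And>x. x \<in> elts (obj A) \<Longrightarrow> f x = g x"
  shows "tfunctor \<T> A B f \<longleftrightarrow> tfunctor \<T> A B g"
proof -
  have "tfunctor \<T> A B f" if g: "tfunctor \<T> A B g" and eq: "\<And>x. x \<in> elts (obj A) \<Longrightarrow> f x = g x" for f g
  proof -
    have gm: "g \<in> elts (obj A) \<rightarrow> elts (obj B)" using g by (simp add: tfunctor_def)
    have "TM \<T> (obj A) (obj B) f t = TM \<T> (obj A) (obj B) g t" if "t \<in> elts (TO \<T> (obj A))" for t
      using TM_cong[OF gm _ that, of f] eq by simp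
    then show ?thesis using g eq by (auto simp: tfunctor_def Pi_iff)
  qed
  from this[of f g] this[of g f] assms show ?thesis by auto
qed

end

text \<open>
  The algebra map is determined up to equivalence by the structure, as \<open>r (\<alpha> t) x = str t x\<close>; hence
  any presentation may be used to compute the dual and to test pseudo-homomorphisms.
\<close>

lemma (in algebra_presentation) rep_map_equiv:
  assumes t: "t \<in> elts TX"
  shows "rep_map \<T> A t \<in> elts X" "1 \<le> r (rep_map \<T> A t) (\<alpha> t)" "1 \<le> r (\<alpha> t) (rep_map \<T> A t)"
proof -
  interpret R: algebra_presentation \<T> A "str0 \<T> A" "rep_map \<T> A"
    by (rule representable_presentation[OF representable])
  show rin: "rep_map \<T> A t \<in> elts X" by (rule R.alg_in[OF t])
  show "1 \<le> r (rep_map \<T> A t) (\<alpha> t)"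
    using R.str_eq[OF t alg_in[OF t]] str_eq[OF t alg_in[OF t]] refl[OF alg_in[OF t]]
    by (simp add: str0_order rin alg_in[OF t])
  show "1 \<le> r (\<alpha> t) (rep_map \<T> A t)"
    using R.str_eq[OF t rin] str_eq[OF t rin] refl[OF rin] by (simp add: str0_order rin alg_in[OF t])
qed

lemma (in algebra_presentation) dual_presentation:
  "algebra_presentation \<T> (dual \<T> A) (rconv r) \<alpha>"
proof unfold_locales
  fix t x assume "t \<in> elts (TO \<T> (obj (dual \<T> A)))" "x \<in> elts (obj (dual \<T> A))"
  then have t: "t \<in> elts TX" and x: "x \<in> elts X" by (simp_all add: dual_def)
  note rt = rep_map_equiv[OF t]
  have "str (dual \<T> A) t x = r x (rep_map \<T> A t)"
    by (simp add: dual_def rcomp_rmap rt rconv_def str0_order x)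
  also have "\<dots> = r x (\<alpha> t)"
    by (intro antisym le_trans_right rt closed t x)
  finally show "str (dual \<T> A) t x = rconv r (\<alpha> t) x" by (simp add: rconv_def)
next
  fix s t assume "s \<in> elts (TO \<T> (obj (dual \<T> A)))" "t \<in> elts (TO \<T> (obj (dual \<T> A)))"
  then show "Txi \<T> (obj (dual \<T> A)) (obj (dual \<T> A)) (rconv r) s t \<le> rconv r (\<alpha> s) (\<alpha> t)"
    by (simp add: Txi_rconv alg_mono) (simp add: rconv_def dual_def alg_mono)
next
  fix x y z
  assume "x \<in> elts (obj (dual \<T> A))" "y \<in> elts (obj (dual \<T> A))" "z \<in> elts (obj (dual \<T> A))"
  then show "rconv r x y * rconv r y z \<le> rconv r x z"
    using trans[of z y x] by (simp add: rconv_def dual_def mult.commute)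
qed (use alg_map in \<open>simp_all add: dual_def rconv_def refl alg_unit alg_mult\<close>)

text \<open>
  In terms of presentations a functor is a monotone map that is lax for the algebra structures,
  and a pseudo-homomorphism is one for which the comparison is an equivalence.
\<close>

locale presentation_pair = A: algebra_presentation \<T> A r \<alpha> + B: algebra_presentation \<T> B q \<beta>
  for \<T> :: "('u::grothendieck_universe, 'v::comm_quantale) ttheory" and A r \<alpha> B q \<beta>
begin

lemma tfunctor_iff: "tfunctor \<T> A B f \<longleftrightarrow> f \<in> elts A.X \<rightarrow> elts B.X \<and>
    (\<forall>x\<in>elts A.X. \<forall>y\<in>elts A.X. r x y \<le> q (f x) (f y)) \<and>
    (\<forall>t\<in>elts A.TX. 1 \<le> q (\<beta> (TM \<T> A.X B.X f t)) (f (\<alpha> t)))"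
  (is "_ \<longleftrightarrow> ?map \<and> ?mono \<and> ?lax")
proof (intro iffI conjI ballI)
  assume f: "tfunctor \<T> A B f"
  then show fm: ?map by (simp add: tfunctor_def)
  have fin: "f x \<in> elts B.X" if "x \<in> elts A.X" for x using fm that by auto
  have le: "r (\<alpha> t) x \<le> q (\<beta> (TM \<T> A.X B.X f t)) (f x)" if "t \<in> elts A.TX" "x \<in> elts A.X" for t x
    using f that A.TM_in[OF fm that(1)] by (auto simp: tfunctor_def A.str_eq B.str_eq fin)
  show "1 \<le> q (\<beta> (TM \<T> A.X B.X f t)) (f (\<alpha> t))" if "t \<in> elts A.TX" for t
    using le[OF that A.alg_in[OF that]] A.refl[OF A.alg_in[OF that]] by (rule order_trans[rotated])
  show "r x y \<le> q (f x) (f y)" if x: "x \<in> elts A.X" and y: "y \<in> elts A.X" for x y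
  proof -
    have "r x y \<le> r (\<alpha> (unit \<T> A.X x)) y"
      by (intro A.le_trans_left A.alg_unit A.closed x y)
    also have "\<dots> \<le> q (\<beta> (unit \<T> B.X (f x))) (f y)"
      using le[OF A.unit_in[OF x] y] by (simp add: A.unit_natural[OF fm x])
    also have "\<dots> \<le> q (f x) (f y)"
      by (intro B.le_trans_left B.alg_unit B.closed fin x y)
    finally show ?thesis .
  qed
next
  assume *: "?map \<and> ?mono \<and> ?lax"
  then have fm: "f \<in> elts A.X \<rightarrow> elts B.X" by simp
  have "str A t x \<le> str B (TM \<T> A.X B.X f t) (f x)" if t: "t \<in> elts A.TX" and x: "x \<in> elts A.X" for t x
  proof -
    have "r (\<alpha> t) x \<le> q (f (\<alpha> t)) (f x)" using * t x A.alg_in by blast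
    also have "\<dots> \<le> q (\<beta> (TM \<T> A.X B.X f t)) (f x)"
      using * fm t x A.alg_in[OF t] A.TM_in[OF fm t] by (intro B.le_trans_left B.closed) auto
    finally show ?thesis by (simp add: A.str_eq B.str_eq A.TM_in[OF fm] funcset_mem[OF fm x] t x)
  qed
  then show "tfunctor \<T> A B f" using fm by (simp add: tfunctor_def)
qed

lemma pseudo_hom_iff: "pseudo_hom \<T> A B f \<longleftrightarrow> tfunctor \<T> A B f \<and>
    (\<forall>t\<in>elts A.TX. 1 \<le> q (f (\<alpha> t)) (\<beta> (TM \<T> A.X B.X f t)))"
proof (cases "tfunctor \<T> A B f")
  case True
  then have fm: "f \<in> elts A.X \<rightarrow> elts B.X"
    and mono: "\<And>x y. x \<in> elts A.X \<Longrightarrow> y \<in> elts A.X \<Longrightarrow> r x y \<le> q (f x) (f y)"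
    and lax: "\<And>t. t \<in> elts A.TX \<Longrightarrow> 1 \<le> q (\<beta> (TM \<T> A.X B.X f t)) (f (\<alpha> t))"
    by (auto simp: tfunctor_iff)
  have fin: "f x \<in> elts B.X" if "x \<in> elts A.X" for x using fm that by auto
  let ?Tf = "TM \<T> A.X B.X f"
  have eq: "map_equiv \<T> A.TX B (\<lambda>t. rep_map \<T> B (?Tf t)) (\<lambda>t. f (rep_map \<T> A t)) \<longleftrightarrow>
    (\<forall>t\<in>elts A.TX. 1 \<le> q (f (\<alpha> t)) (\<beta> (?Tf t)))"
  proof -
    have "1 \<le> str0 \<T> B (rep_map \<T> B (?Tf t)) (f (rep_map \<T> A t))
      \<and> (1 \<le> str0 \<T> B (f (rep_map \<T> A t)) (rep_map \<T> B (?Tf t)) \<longleftrightarrow>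
          1 \<le> q (f (\<alpha> t)) (\<beta> (?Tf t)))" if t: "t \<in> elts A.TX" for t
    proof -
      note Tt = A.TM_in[OF fm t]
      note a = A.rep_map_equiv[OF t] and b = B.rep_map_equiv[OF Tt]
      note cl = a(1) b(1) A.alg_in[OF t] B.alg_in[OF Tt] fin
      have fa: "1 \<le> q (f (rep_map \<T> A t)) (f (\<alpha> t))" "1 \<le> q (f (\<alpha> t)) (f (rep_map \<T> A t))"
        using mono a A.alg_in[OF t] by (blast intro: order_trans)+
      have "1 \<le> q (rep_map \<T> B (?Tf t)) (f (rep_map \<T> A t))"
        by (rule B.le_trans[OF b(2) B.le_trans[OF lax[OF t] fa(2)]]) (simp_all add: cl)
      moreover have "1 \<le> q (f (\<alpha> t)) (\<beta> (?Tf t))"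
        if "1 \<le> q (f (rep_map \<T> A t)) (rep_map \<T> B (?Tf t))"
        by (rule B.le_trans[OF fa(2) B.le_trans[OF that b(2)]]) (simp_all add: cl)
      moreover have "1 \<le> q (f (rep_map \<T> A t)) (rep_map \<T> B (?Tf t))"
        if "1 \<le> q (f (\<alpha> t)) (\<beta> (?Tf t))"
        by (rule B.le_trans[OF fa(1) B.le_trans[OF that b(3)]]) (simp_all add: cl)
      ultimately show ?thesis by (auto simp: B.str0_order cl)
    qed
    then show ?thesis by (auto simp: map_equiv_def map_le_def)
  qed
  then show ?thesis by (simp add: pseudo_hom_def A.representable B.representable True)
qed (simp add: pseudo_hom_def)

lemma adjoint_iff: "adjoint \<T> A B f g \<longleftrightarrow> tfunctor \<T> A B f \<and> tfunctor \<T> B A g \<and>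
    (\<forall>x\<in>elts A.X. 1 \<le> r x (g (f x))) \<and> (\<forall>y\<in>elts B.X. 1 \<le> q (f (g y)) y)"
proof -
  have "map_le \<T> A.X A (\<lambda>x. x) (\<lambda>x. g (f x)) \<longleftrightarrow> (\<forall>x\<in>elts A.X. 1 \<le> r x (g (f x)))"
    "map_le \<T> B.X B (\<lambda>y. f (g y)) (\<lambda>y. y) \<longleftrightarrow> (\<forall>y\<in>elts B.X. 1 \<le> q (f (g y)) y)"
    if "f \<in> elts A.X \<rightarrow> elts B.X" "g \<in> elts B.X \<rightarrow> elts A.X"
    using that by (auto simp: map_le_def A.str0_order B.str0_order Pi_iff)
  then show ?thesis by (auto simp: adjoint_def tfunctor_def)
qed

text \<open>
  Applying \<open>T\<close> and \<open>\<alpha>\<close> to the unit \<open>1 \<le> g \<cdot> f\<close> gives \<open>\<alpha> \<le> \<alpha> \<cdot> Tg \<cdot> Tf \<le> g \<cdot> \<beta> \<cdot> Tf\<close>, where the last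
  step is laxness of \<open>g\<close>; transposing along the adjunction yields \<open>f \<cdot> \<alpha> \<le> \<beta> \<cdot> Tf\<close>.
\<close>

lemma left_adjoint_pseudo_hom:
  assumes adj: "adjoint \<T> A B f g"
  shows "pseudo_hom \<T> A B f"
proof -
  interpret BA: presentation_pair \<T> B q \<beta> A r \<alpha> ..
  from adj have f: "tfunctor \<T> A B f" and g: "tfunctor \<T> B A g"
    and adj_unit: "\<And>x. x \<in> elts A.X \<Longrightarrow> 1 \<le> r x (g (f x))"
    and adj_counit: "\<And>y. y \<in> elts B.X \<Longrightarrow> 1 \<le> q (f (g y)) y"
    by (auto simp: adjoint_iff)
  have fm: "f \<in> elts A.X \<rightarrow> elts B.X" and gm: "g \<in> elts B.X \<rightarrow> elts A.X"
    using f g by (simp_all add: tfunctor_def)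
  have fin: "f x \<in> elts B.X" if "x \<in> elts A.X" for x using fm that by auto
  have gin: "g x \<in> elts A.X" if "x \<in> elts B.X" for x using gm that by auto
  have gfm: "(\<lambda>x. g (f x)) \<in> elts A.X \<rightarrow> elts A.X" by (auto simp: fin gin)
  have "1 \<le> q (f (\<alpha> t)) (\<beta> (TM \<T> A.X B.X f t))" if t: "t \<in> elts A.TX" for t
  proof -
    let ?s = "TM \<T> A.X B.X f t"
    let ?u = "TM \<T> A.X A.X (\<lambda>x. g (f x)) t"
    have s: "?s \<in> elts B.TX" and u: "?u \<in> elts A.TX" by (intro A.TM_in fm gfm t)+
    note cl = A.alg_in[OF t] A.alg_in[OF u] B.alg_in[OF s] fin gin
    have "1 \<le> r (\<alpha> t) (\<alpha> ?u)"
      using A.Txi_total[OF gfm, of r, OF adj_unit t] A.alg_mono[OF t u] by (rule order_trans) auto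
    moreover have "1 \<le> r (\<alpha> ?u) (g (\<beta> ?s))"
      using g s by (simp add: BA.tfunctor_iff A.TM_comp[OF fm gm t])
    ultimately have "1 \<le> r (\<alpha> t) (g (\<beta> ?s))" by (rule A.le_trans) (simp_all add: cl)
    moreover have "r (\<alpha> t) (g (\<beta> ?s)) \<le> q (f (\<alpha> t)) (f (g (\<beta> ?s)))"
      using f cl by (auto simp: tfunctor_iff)
    ultimately have "1 \<le> q (f (\<alpha> t)) (f (g (\<beta> ?s)))" by (rule order_trans)
    then show ?thesis by (rule B.le_trans[OF _ adj_counit]) (simp_all add: cl)
  qed
  then show ?thesis using f by (simp add: pseudo_hom_iff)
qed

text \<open>
  Reversing both orders exchanges the two halves of the comparison \<open>\<beta> \<cdot> Tf \<simeq> f \<cdot> \<alpha>\<close>. The categories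
  \<open>A'\<close> and \<open>B'\<close> are only required to be presented by the reversed orders, so that the lemma also
  leads back from a dual to the category itself.
\<close>

lemma pseudo_hom_opposite:
  assumes "pseudo_hom \<T> A B f" "presentation_pair \<T> A' (rconv r) \<alpha> B' (rconv q) \<beta>"
    "obj A' = obj A" "obj B' = obj B"
  shows "pseudo_hom \<T> A' B' f"
proof -
  interpret op: presentation_pair \<T> A' "rconv r" \<alpha> B' "rconv q" \<beta> by fact
  show ?thesis using assms(1)
    by (simp add: pseudo_hom_iff tfunctor_iff op.pseudo_hom_iff op.tfunctor_iff assms(3,4) rconv_def)
qed

end

lemma adjoint_comp:
  assumes AB: "presentation_pair \<T> A r \<alpha> B q \<beta>" and BC: "presentation_pair \<T> B q \<beta> C p \<gamma>"
    and fg: "adjoint \<T> A B f g" and hk: "adjoint \<T> B C h k"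
  shows "adjoint \<T> A C (\<lambda>x. h (f x)) (\<lambda>x. g (k x))"
proof -
  interpret AB: presentation_pair \<T> A r \<alpha> B q \<beta> by fact
  interpret BC: presentation_pair \<T> B q \<beta> C p \<gamma> by fact
  interpret BA: presentation_pair \<T> B q \<beta> A r \<alpha> ..
  interpret AC: presentation_pair \<T> A r \<alpha> C p \<gamma> ..
  from fg hk have funs: "tfunctor \<T> A B f" "tfunctor \<T> B A g" "tfunctor \<T> B C h" "tfunctor \<T> C B k"
    by (simp_all add: adjoint_def)
  then have in_: "\<And>x. x \<in> elts (obj A) \<Longrightarrow> f x \<in> elts (obj B)" "\<And>x. x \<in> elts (obj B) \<Longrightarrow> g x \<in> elts (obj A)"
      "\<And>x. x \<in> elts (obj B) \<Longrightarrow> h x \<in> elts (obj C)" "\<And>x. x \<in> elts (obj C) \<Longrightarrow> k x \<in> elts (obj B)"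
    by (auto simp: tfunctor_def)
  have "1 \<le> r x (g (k (h (f x))))" if x: "x \<in> elts (obj A)" for x
  proof (rule AB.A.le_trans)
    show "1 \<le> r x (g (f x))" using fg x by (simp add: AB.adjoint_iff)
    have "1 \<le> q (f x) (k (h (f x)))" using hk x by (simp add: BC.adjoint_iff in_)
    also have "\<dots> \<le> r (g (f x)) (g (k (h (f x))))"
      using funs(2) x by (simp add: BA.tfunctor_iff in_)
    finally show "1 \<le> r (g (f x)) (g (k (h (f x))))" .
  qed (simp_all add: in_ x)
  moreover have "1 \<le> p (h (f (g (k x)))) x" if x: "x \<in> elts (obj C)" for x
  proof (rule BC.B.le_trans)
    have "1 \<le> q (f (g (k x))) (k x)" using fg x by (simp add: AB.adjoint_iff in_)
    also have "\<dots> \<le> p (h (f (g (k x)))) (h (k x))"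
      using funs(3) x by (simp add: BC.tfunctor_iff in_)
    finally show "1 \<le> p (h (f (g (k x)))) (h (k x))" .
    show "1 \<le> p (h (k x)) x" using hk x by (simp add: BC.adjoint_iff)
  qed (simp_all add: in_ x)
  ultimately show ?thesis
    using funs by (simp add: AC.adjoint_iff AB.A.tfunctor_comp[of A B f C h] AB.A.tfunctor_comp[of C B k A g])
qed

text \<open>
  If \<open>f\<close> is left adjoint to \<open>i \<cdot> h\<close>, then the unit at \<open>i x\<close> is an inequality between values of \<open>i\<close>, which
  can be cancelled when \<open>i\<close> reflects the order.
\<close>

lemma adjoint_cancel:
  assumes AB: "presentation_pair \<T> A r \<alpha> B q \<beta>" and BC: "presentation_pair \<T> B q \<beta> C p \<gamma>"
    and adj: "adjoint \<T> A C f (\<lambda>x. i (h x))"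
    and i: "tfunctor \<T> B A i" and h: "tfunctor \<T> C B h"
    and reflect: "\<And>x y. x \<in> elts (obj B) \<Longrightarrow> y \<in> elts (obj B) \<Longrightarrow> 1 \<le> r (i x) (i y) \<Longrightarrow> 1 \<le> q x y"
  shows "adjoint \<T> B C (\<lambda>x. f (i x)) h"
proof -
  interpret AB: presentation_pair \<T> A r \<alpha> B q \<beta> by fact
  interpret BC: presentation_pair \<T> B q \<beta> C p \<gamma> by fact
  interpret AC: presentation_pair \<T> A r \<alpha> C p \<gamma> ..
  have f: "tfunctor \<T> A C f" using adj by (simp add: adjoint_def)
  have in_: "\<And>x. x \<in> elts (obj B) \<Longrightarrow> i x \<in> elts (obj A)" "\<And>x. x \<in> elts (obj A) \<Longrightarrow> f x \<in> elts (obj C)"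
      "\<And>x. x \<in> elts (obj C) \<Longrightarrow> h x \<in> elts (obj B)"
    using f i h by (auto simp: tfunctor_def)
  show ?thesis
    using adj h AB.A.tfunctor_comp[OF i f] by (auto simp: AC.adjoint_iff BC.adjoint_iff in_ intro: reflect)
qed

section \<open>Copresheaves on a representable category\<close>

context topological_theory
begin

lemma ev_fun_elt: "x \<in> elts X \<Longrightarrow> ev \<T> (fun_elt X (\<lambda>x. enc \<T> (\<phi> x))) x = \<phi> x"
  by (simp add: ev_def app_fun_elt dec_enc)

text \<open>The order underlying the category of copresheaves is the reversed pointwise order.\<close>

definition presheaf_order :: "('u, 'v) tcat \<Rightarrow> 'u \<Rightarrow> 'u \<Rightarrow> 'v" where
  "presheaf_order A F G = (INF x\<in>elts (obj A). qhom (ev \<T> G x) (ev \<T> F x))"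

lemma presheaf_order_ev: "x \<in> elts (obj A) \<Longrightarrow> presheaf_order A F G * ev \<T> G x \<le> ev \<T> F x"
  unfolding qhom_adjunction presheaf_order_def by (rule INF_lower)

lemma le_presheaf_orderI:
  "(\<And>x. x \<in> elts (obj A) \<Longrightarrow> v * ev \<T> G x \<le> ev \<T> F x) \<Longrightarrow> v \<le> presheaf_order A F G"
  unfolding qhom_adjunction presheaf_order_def by (rule INF_greatest)

lemma unit_le_presheaf_order:
  "1 \<le> presheaf_order A F G \<longleftrightarrow> (\<forall>x\<in>elts (obj A). ev \<T> G x \<le> ev \<T> F x)"
  by (simp add: presheaf_order_def le_INF_iff unit_le_qhom)

definition presheaf_algebra :: "('u, 'v) tcat \<Rightarrow> 'u \<Rightarrow> 'u" where
  "presheaf_algebra A p = fun_elt (obj A) (\<lambda>x. enc \<T> (mu \<T> A p x))"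

lemma ev_presheaf_algebra: "x \<in> elts (obj A) \<Longrightarrow> ev \<T> (presheaf_algebra A p) x = mu \<T> A p x"
  unfolding presheaf_algebra_def by (rule ev_fun_elt)

lemma mu_upper:
  "t \<in> elts (TO \<T> (obj A)) \<Longrightarrow>
    Txi \<T> (presheaves \<T> A) (obj A) (ev \<T>) p t * str A t x \<le> mu \<T> A p x"
  unfolding mu_def by (rule rcomp_upper)

lemma mu_least:
  "(\<And>t. t \<in> elts (TO \<T> (obj A)) \<Longrightarrow>
      Txi \<T> (presheaves \<T> A) (obj A) (ev \<T>) p t * str A t x \<le> v) \<Longrightarrow> mu \<T> A p x \<le> v"
  unfolding mu_def rcomp_def by (rule SUP_least)

end

context algebra_presentation
begin

lemma presheafI:
  assumes mono: "\<And>x y. x \<in> elts X \<Longrightarrow> y \<in> elts X \<Longrightarrow> \<phi> x * r x y \<le> \<phi> y"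
    and alg: "\<And>t. t \<in> elts TX \<Longrightarrow> xiT \<T> X \<phi> t \<le> \<phi> (\<alpha> t)"
  shows "fun_elt X (\<lambda>x. enc \<T> (\<phi> x)) \<in> elts (presheaves \<T> A)"
proof -
  have "str A t x * xiT \<T> X \<phi> t \<le> \<phi> x" if t: "t \<in> elts TX" and x: "x \<in> elts X" for t x
  proof -
    have "str A t x * xiT \<T> X \<phi> t \<le> r (\<alpha> t) x * \<phi> (\<alpha> t)"
      by (intro tensor_mono alg t) (simp add: str_eq t x)
    also have "\<dots> \<le> \<phi> x" using mono[OF alg_in[OF t] x] by (simp add: mult.commute)
    finally show ?thesis .
  qed
  then have "tfunctor \<T> A (quantale_cat \<T>) (\<lambda>x. enc \<T> (\<phi> x))"
    by (simp add: tfunctor_def quantale_cat_def elts_Vset dec_enc qhom_adjunction[symmetric] xiT_def)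
  then show ?thesis unfolding elts_presheaves by blast
qed

lemma
  assumes F: "F \<in> elts (presheaves \<T> A)"
  shows presheaf_str: "\<And>t x. t \<in> elts TX \<Longrightarrow> x \<in> elts X \<Longrightarrow> xiT \<T> X (ev \<T> F) t * str A t x \<le> ev \<T> F x"
    and presheaf_mono: "\<And>x y. x \<in> elts X \<Longrightarrow> y \<in> elts X \<Longrightarrow> ev \<T> F x * r x y \<le> ev \<T> F y"
    and presheaf_alg: "\<And>t. t \<in> elts TX \<Longrightarrow> xiT \<T> X (ev \<T> F) t \<le> ev \<T> F (\<alpha> t)"
proof -
  from F obtain f where f: "F = fun_elt X f" "tfunctor \<T> A (quantale_cat \<T>) f"
    unfolding elts_presheaves by blast
  have fm: "f \<in> elts X \<rightarrow> elts (Vset \<T>)" using f(2) by (simp add: tfunctor_def quantale_cat_def)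
  have ev: "ev \<T> F x = dec \<T> (f x)" "f x = enc \<T> (ev \<T> F x)" if "x \<in> elts X" for x
    using funcset_mem[OF fm that] that by (auto simp: f(1) ev_def app_fun_elt elts_Vset dec_enc)
  show str: "xiT \<T> X (ev \<T> F) t * str A t x \<le> ev \<T> F x" if t: "t \<in> elts TX" and x: "x \<in> elts X" for t x
  proof -
    have "xiT \<T> X (ev \<T> F) t = xi \<T> (TM \<T> X (Vset \<T>) f t)"
      unfolding xiT_def using TM_cong[OF fm ev(2) t] by simp
    moreover have "str A t x \<le> qhom (xi \<T> (TM \<T> X (Vset \<T>) f t)) (dec \<T> (f x))"
      using f(2) t x by (simp add: tfunctor_def quantale_cat_def)
    ultimately show ?thesis by (simp add: qhom_adjunction[symmetric] ev(1)[OF x] mult.commute)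
  qed
  show "xiT \<T> X (ev \<T> F) t \<le> ev \<T> F (\<alpha> t)" if t: "t \<in> elts TX" for t
    using str[OF t alg_in[OF t]] unit_le_tensor[OF refl[OF alg_in[OF t]], of "xiT \<T> X (ev \<T> F) t"]
    by (simp add: str_eq t alg_in mult.commute)
  show "ev \<T> F x * r x y \<le> ev \<T> F y" if x: "x \<in> elts X" and y: "y \<in> elts X" for x y
    using str[OF unit_in[OF x] y] by (simp add: xiT_unit x y str0_order str0_eq[symmetric])
qed

lemma presheaf_le: "F \<in> elts (presheaves \<T> A) \<Longrightarrow> 1 \<le> r x y \<Longrightarrow> x \<in> elts X \<Longrightarrow> y \<in> elts X \<Longrightarrow>
    ev \<T> F x \<le> ev \<T> F y"
  using presheaf_mono[of F x y] tensor_le_if_le[of "r x y" "ev \<T> F x" "ev \<T> F y"]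
  by (simp add: mult.commute)

abbreviation "PA \<equiv> presheaves \<T> A"

text \<open>
  The next two lemmas say that \<open>mu \<cdot> m = a \<cdot> T mu\<close>, which follows from \<open>a \<cdot> Ta = a \<cdot> m\<close> for representable
  \<open>A\<close> and from the compatibility of extended relations with the multiplication. It yields both
  that \<open>mu p\<close> is a copresheaf and the associativity law for \<open>presheaf_algebra\<close>.
\<close>

lemma mu_mult_upper:
  assumes S: "S \<in> elts (TO \<T> (TO \<T> PA))" and t: "t \<in> elts TX" and x: "x \<in> elts X"
  shows "Txi \<T> (TO \<T> PA) X (mu \<T> A) S t * str A t x \<le> mu \<T> A (mult \<T> PA S) x"
  unfolding mu_def[of \<T> A, THEN arg_cong, of "\<lambda>m. Txi \<T> (TO \<T> PA) X m S t"] Txi_rcomp SUP_tensor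
proof (rule SUP_least)
  fix u assume u: "u \<in> elts (TO \<T> TX)"
  let ?E = "Txi \<T> PA X (ev \<T>)"
  have "Txi \<T> (TO \<T> PA) TX ?E S u * (Txi \<T> TX X (str A) u t * str A t x)
      \<le> ?E (mult \<T> PA S) (mult \<T> X u) * str A (mult \<T> X u) x"
    by (intro tensor_mono Txi_mult_lax tcategory_trans_mult tcategory u t x)
  also have "\<dots> \<le> mu \<T> A (mult \<T> PA S) x" by (intro mu_upper closed u)
  finally show "Txi \<T> (TO \<T> PA) TX ?E S u * Txi \<T> TX X (str A) u t * str A t x
      \<le> mu \<T> A (mult \<T> PA S) x"
    by (simp add: mult.assoc)
qed

lemma mu_mult_lower:
  assumes S: "S \<in> elts (TO \<T> (TO \<T> PA))" and x: "x \<in> elts X"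
  shows "mu \<T> A (mult \<T> PA S) x \<le> (SUP t\<in>elts TX. Txi \<T> (TO \<T> PA) X (mu \<T> A) S t * str A t x)"
proof (rule mu_least)
  fix t assume t: "t \<in> elts TX"
  let ?E = "Txi \<T> PA X (ev \<T>)"
  let ?R = "SUP t\<in>elts TX. Txi \<T> (TO \<T> PA) X (mu \<T> A) S t * str A t x"
  have "?E (mult \<T> PA S) t * str A t x \<le>
      (SUP v\<in>{v \<in> elts (TO \<T> TX). mult \<T> X v = t}. Txi \<T> (TO \<T> PA) TX ?E S v) * str A t x"
    by (intro tensor_mono Txi_mult_oplax_right S order_refl)
  also have "\<dots> \<le> ?R"
    unfolding SUP_tensor
  proof (rule SUP_least)
    fix v assume "v \<in> {v \<in> elts (TO \<T> TX). mult \<T> X v = t}"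
    then have v: "v \<in> elts (TO \<T> TX)" "mult \<T> X v = t" by auto
    have "1 \<le> Txi \<T> TX X (str A) v (T\<alpha> v)"
      by (rule Txi_total[OF alg_map _ v(1)]) (simp add: str_eq refl closed)
    then have "Txi \<T> (TO \<T> PA) TX ?E S v \<le> Txi \<T> (TO \<T> PA) TX ?E S v * Txi \<T> TX X (str A) v (T\<alpha> v)"
      using tensor_mono[OF order_refl] by fastforce
    also have "\<dots> \<le> Txi \<T> (TO \<T> PA) X (mu \<T> A) S (T\<alpha> v)"
      unfolding mu_def by (rule Txi_rcomp_upper[OF v(1)])
    finally have "Txi \<T> (TO \<T> PA) TX ?E S v * str A t x
        \<le> Txi \<T> (TO \<T> PA) X (mu \<T> A) S (T\<alpha> v) * str A (T\<alpha> v) x"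
      using v t x alg_mult(2)[OF v(1)]
      by (intro tensor_mono) (auto simp: str_eq closed intro!: le_trans_left)
    also have "\<dots> \<le> ?R" by (intro SUP_upper closed v)
    finally show "Txi \<T> (TO \<T> PA) TX ?E S v * str A t x \<le> ?R" .
  qed
  finally show "?E (mult \<T> PA S) t * str A t x \<le> ?R" .
qed

text \<open>
  By \<open>Txi_row\<close>, extending the map \<open>mu p\<close> is the same as extending the relation \<open>mu\<close> at \<open>unit p\<close>, to
  which \<open>mu_mult_upper\<close> applies.
\<close>

lemma presheaf_algebra_in:
  assumes T1: "\<exists>t. elts (TO \<T> one) = {t}" and p: "p \<in> elts (TO \<T> PA)"
  shows "presheaf_algebra A p \<in> elts PA"
  unfolding presheaf_algebra_def
proof (rule presheafI)
  have "unit \<T> (TO \<T> PA) p \<in> elts (TO \<T> (TO \<T> PA))" by (rule unit_in[OF p])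
  then have *: "xiT \<T> X (mu \<T> A p) t * str A t x \<le> mu \<T> A p x" if "t \<in> elts TX" "x \<in> elts X" for t x
    using mu_mult_upper[of "unit \<T> (TO \<T> PA) p" t x] Txi_row[OF T1 p that(1), of "mu \<T> A"]
      mult_unit[OF p] that by simp
  show "xiT \<T> X (mu \<T> A p) t \<le> mu \<T> A p (\<alpha> t)" if t: "t \<in> elts TX" for t
    using *[OF t alg_in[OF t]] unit_le_tensor[OF refl[OF alg_in[OF t]], of "xiT \<T> X (mu \<T> A p) t"]
    by (simp add: str_eq t alg_in mult.commute)
  show "mu \<T> A p x * r x y \<le> mu \<T> A p y" if x: "x \<in> elts X" and y: "y \<in> elts X" for x y
    using *[OF unit_in[OF x] y] by (simp add: xiT_unit x y str0_order str0_eq[symmetric])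
qed

lemma mu_unit:
  assumes F: "F \<in> elts PA" and x: "x \<in> elts X"
  shows "mu \<T> A (unit \<T> PA F) x = ev \<T> F x"
proof (rule antisym)
  show "mu \<T> A (unit \<T> PA F) x \<le> ev \<T> F x"
  proof (rule mu_least)
    fix t assume t: "t \<in> elts TX"
    show "Txi \<T> PA X (ev \<T>) (unit \<T> PA F) t * str A t x \<le> ev \<T> F x"
      using tensor_mono[OF Txi_row_le[OF F] order_refl] presheaf_str[OF F t x] by (rule order_trans)
  qed
  have "ev \<T> F x \<le> Txi \<T> PA X (ev \<T>) (unit \<T> PA F) (unit \<T> X x) * str A (unit \<T> X x) x"
    using tensor_mono[OF Txi_unit_lax[OF F x, of "ev \<T>"] tcategory_refl[OF tcategory x]] by simp
  also have "\<dots> \<le> mu \<T> A (unit \<T> PA F) x" by (intro mu_upper closed x)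
  finally show "ev \<T> F x \<le> mu \<T> A (unit \<T> PA F) x" .
qed

text \<open>
  Evaluation satisfies \<open>ev \<cdot> c \<le> ev\<close> for the order \<open>c\<close> of copresheaves. Extending this inequality makes
  the algebra monotone; \<open>mu_unit\<close> and \<open>mu_mult_upper\<close> with its converse give the algebra laws as
  equalities.
\<close>

lemma Vcat_presentation:
  assumes T1: "\<exists>t. elts (TO \<T> one) = {t}"
  shows "algebra_presentation \<T> (Vcat \<T> A) (presheaf_order A) (presheaf_algebra A)"
proof -
  have obj: "obj (Vcat \<T> A) = PA" by (simp add: Vcat_def)
  let ?g = "presheaf_algebra A" and ?r = "presheaf_order A"
  let ?E = "Txi \<T> PA X (ev \<T>)"
  have g: "?g \<in> elts (TO \<T> PA) \<rightarrow> elts PA" using presheaf_algebra_in[OF T1] by auto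
  have mult: "mu \<T> A (TM \<T> (TO \<T> PA) PA ?g S) x = mu \<T> A (mult \<T> PA S) x"
    if S: "S \<in> elts (TO \<T> (TO \<T> PA))" and x: "x \<in> elts X" for S x
  proof -
    have "?E (TM \<T> (TO \<T> PA) PA ?g S) t = Txi \<T> (TO \<T> PA) X (mu \<T> A) S t" for t
      using Txi_comp_map[OF g S, of X "ev \<T>" t]
        Txi_cong[of "TO \<T> PA" X "\<lambda>p. ev \<T> (?g p)" "mu \<T> A"] by (simp add: ev_presheaf_algebra)
    then have "mu \<T> A (TM \<T> (TO \<T> PA) PA ?g S) x =
        (SUP t\<in>elts TX. Txi \<T> (TO \<T> PA) X (mu \<T> A) S t * str A t x)"
      by (simp add: mu_def[of \<T> A, THEN fun_cong] rcomp_def)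
    also have "\<dots> = mu \<T> A (mult \<T> PA S) x"
      by (intro antisym mu_mult_lower SUP_least mu_mult_upper S x)
    finally show ?thesis .
  qed
  show ?thesis
  proof unfold_locales
    fix p q assume "p \<in> elts (TO \<T> (obj (Vcat \<T> A)))" "q \<in> elts (TO \<T> (obj (Vcat \<T> A)))"
    show "Txi \<T> (obj (Vcat \<T> A)) (obj (Vcat \<T> A)) ?r p q \<le> ?r (?g p) (?g q)"
      unfolding obj
    proof (rule le_presheaf_orderI)
      fix x assume x: "x \<in> elts X"
      have "Txi \<T> PA PA ?r p q * mu \<T> A q x = (SUP t\<in>elts TX. (Txi \<T> PA PA ?r p q * ?E q t) * str A t x)"
        by (simp add: mu_def rcomp_def tensor_SUP mult.assoc)
      also have "\<dots> \<le> mu \<T> A p x"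
      proof (rule SUP_least)
        fix t assume t: "t \<in> elts TX"
        have "Txi \<T> PA PA ?r p q * ?E q t \<le> Txi \<T> PA X (rcomp PA (ev \<T>) ?r) p t"
          using \<open>q \<in> _\<close> by (intro Txi_rcomp_upper) (simp add: obj)
        also have "\<dots> \<le> ?E p t"
          by (intro Txi_mono) (auto simp: rcomp_def intro!: SUP_least presheaf_order_ev)
        finally have "Txi \<T> PA PA ?r p q * ?E q t * str A t x \<le> ?E p t * str A t x"
          by (intro tensor_mono order_refl)
        also have "\<dots> \<le> mu \<T> A p x" by (rule mu_upper[OF t])
        finally show "Txi \<T> PA PA ?r p q * ?E q t * str A t x \<le> mu \<T> A p x" .
      qed
      finally show "Txi \<T> PA PA ?r p q * ev \<T> (?g q) x \<le> ev \<T> (?g p) x"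
        by (simp add: ev_presheaf_algebra x)
    qed
  next
    fix F G H
    show "?r F G * ?r G H \<le> ?r F H"
    proof (rule le_presheaf_orderI)
      fix x assume x: "x \<in> elts X"
      have "?r F G * (?r G H * ev \<T> H x) \<le> ?r F G * ev \<T> G x"
        by (intro tensor_mono order_refl presheaf_order_ev x)
      also have "\<dots> \<le> ev \<T> F x" by (rule presheaf_order_ev[OF x])
      finally show "?r F G * ?r G H * ev \<T> H x \<le> ev \<T> F x" by (simp add: mult.assoc)
    qed
  next
    fix p F
    show "str (Vcat \<T> A) p F = ?r (?g p) F"
      by (simp add: Vcat_def presheaf_order_def ev_presheaf_algebra)
  qed (use g in \<open>simp_all add: obj unit_le_presheaf_order ev_presheaf_algebra mu_unit mult\<close>)
qed

lemma hmap_in: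
  assumes T1: "\<exists>t. elts (TO \<T> one) = {t}" and x: "x \<in> elts X"
  shows "hmap \<T> A x \<in> elts PA"
proof -
  have "xiT \<T> X (r x) t \<le> r x (\<alpha> t)" if t: "t \<in> elts TX" for t
  proof -
    have "xiT \<T> X (r x) t = Txi \<T> X X r (unit \<T> X x) t" by (rule Txi_row[OF T1 x t, symmetric])
    also have "\<dots> \<le> r (\<alpha> (unit \<T> X x)) (\<alpha> t)" by (intro alg_mono closed x t)
    also have "\<dots> \<le> r x (\<alpha> t)" by (intro le_trans_left alg_unit closed x t)
    finally show ?thesis .
  qed
  then have "fun_elt X (\<lambda>y. enc \<T> (r x y)) \<in> elts PA" by (intro presheafI trans x) auto
  moreover have "hmap \<T> A x = fun_elt X (\<lambda>y. enc \<T> (r x y))"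
    unfolding hmap_def by (rule fun_elt_cong) (simp add: str0_order x)
  ultimately show ?thesis by simp
qed

lemma ev_hmap: "x \<in> elts X \<Longrightarrow> y \<in> elts X \<Longrightarrow> ev \<T> (hmap \<T> A x) y = r x y"
  by (simp add: hmap_def ev_fun_elt str0_order)

text \<open>
  Since \<open>ev \<cdot> hmap = r\<close>, the copresheaf \<open>mu (T hmap t)\<close> is \<open>a \<cdot> Tr\<close> at \<open>t\<close>, which equals \<open>a\<close> by
  monotonicity of \<open>\<alpha>\<close>; so the comparison is an equality.
\<close>

lemma hmap_pseudo_hom:
  assumes T1: "\<exists>t. elts (TO \<T> one) = {t}"
  shows "pseudo_hom \<T> A (Vcat \<T> A) (hmap \<T> A)"
proof -
  interpret V: algebra_presentation \<T> "Vcat \<T> A" "presheaf_order A" "presheaf_algebra A"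
    by (rule Vcat_presentation[OF T1])
  interpret AV: presentation_pair \<T> A r \<alpha> "Vcat \<T> A" "presheaf_order A" "presheaf_algebra A" ..
  have obj: "obj (Vcat \<T> A) = PA" by (simp add: Vcat_def)
  let ?h = "hmap \<T> A"
  have h: "?h \<in> elts X \<rightarrow> elts PA" using hmap_in[OF T1] by auto
  have Txi_h: "Txi \<T> PA X (ev \<T>) (TM \<T> X PA ?h t) s = Txi \<T> X X r t s" if t: "t \<in> elts TX" for s t
    using Txi_comp_map[OF h t, of X "ev \<T>" s] Txi_cong[of X X "\<lambda>x. ev \<T> (?h x)" r t s]
    by (simp add: ev_hmap)
  have mu: "mu \<T> A (TM \<T> X PA ?h t) z = r (\<alpha> t) z" if t: "t \<in> elts TX" and z: "z \<in> elts X" for t z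
  proof (rule antisym)
    show "mu \<T> A (TM \<T> X PA ?h t) z \<le> r (\<alpha> t) z"
    proof (rule mu_least)
      fix s assume s: "s \<in> elts TX"
      have "Txi \<T> X X r t s * r (\<alpha> s) z \<le> r (\<alpha> t) (\<alpha> s) * r (\<alpha> s) z"
        by (intro tensor_mono alg_mono order_refl s t)
      also have "\<dots> \<le> r (\<alpha> t) z" by (intro trans closed s t z)
      finally show "Txi \<T> PA X (ev \<T>) (TM \<T> X PA ?h t) s * str A s z \<le> r (\<alpha> t) z"
        by (simp add: Txi_h t s z str_eq)
    qed
    have "r (\<alpha> t) z \<le> Txi \<T> X X r t t * r (\<alpha> t) z"
      by (intro unit_le_tensor Txi_refl refl t)
    also have "\<dots> \<le> mu \<T> A (TM \<T> X PA ?h t) z"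
      using mu_upper[OF t, of "TM \<T> X PA ?h t" z] by (simp add: Txi_h t z str_eq)
    finally show "r (\<alpha> t) z \<le> mu \<T> A (TM \<T> X PA ?h t) z" .
  qed
  have "r x y \<le> presheaf_order A (?h x) (?h y)" if "x \<in> elts X" "y \<in> elts X" for x y
    using that by (intro le_presheaf_orderI) (simp add: ev_hmap trans)
  then show ?thesis
    using h by (simp add: AV.pseudo_hom_iff AV.tfunctor_iff obj unit_le_presheaf_order
      ev_presheaf_algebra ev_hmap mu closed)
qed

end

section \<open>Left Kan extension along the algebra structure\<close>

text \<open>
  The categories of the theorem with their presentations, for a category \<open>A\<close> presented by \<open>(r, \<alpha>)\<close>.
  Both \<open>VDop\<close> and \<open>Pcat \<T> A\<close> are duals of copresheaf categories, so their order is pointwise.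
\<close>

locale representable_dual = algebra_presentation +
  assumes T1: "\<exists>t. elts (TO \<T> one) = {t}"
begin

abbreviation "D \<equiv> dual \<T> A"
abbreviation "DT \<equiv> dual \<T> (Tcat \<T> A)"
abbreviation "VDop \<equiv> dual \<T> (Vcat \<T> D)"

sublocale D: algebra_presentation \<T> D "rconv r" \<alpha>
  by (rule dual_presentation)

sublocale T: algebra_presentation \<T> "Tcat \<T> A" "hat \<T> A" "mult \<T> X"
  by (rule Tcat_presentation[OF tcategory])

sublocale DT: algebra_presentation \<T> DT "rconv (hat \<T> A)" "mult \<T> X"
  by (rule T.dual_presentation)

sublocale VD: algebra_presentation \<T> "Vcat \<T> D" "presheaf_order D" "presheaf_algebra D"
  by (rule D.Vcat_presentation[OF T1])

sublocale VDop: algebra_presentation \<T> VDop "rconv (presheaf_order D)" "presheaf_algebra D"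
  by (rule VD.dual_presentation)

sublocale VDT: algebra_presentation \<T> "Vcat \<T> DT" "presheaf_order DT" "presheaf_algebra DT"
  by (rule DT.Vcat_presentation[OF T1])

sublocale P: algebra_presentation \<T> "Pcat \<T> A" "rconv (presheaf_order DT)" "presheaf_algebra DT"
  unfolding Pcat_def by (rule VDT.dual_presentation)

lemma objs: "obj D = X" "obj DT = TX" "obj VDop = presheaves \<T> D" "obj (Vcat \<T> D) = presheaves \<T> D"
    "obj (Pcat \<T> A) = presheaves \<T> DT"
  by (simp_all add: dual_def Pcat_def Vcat_def obj_Tcat)

definition precompose :: "'a \<Rightarrow> 'a" where
  "precompose F = fun_elt TX (\<lambda>t. enc \<T> (ev \<T> F (\<alpha> t)))"

text \<open>
  The ordinary left Kan extension along \<open>\<alpha>\<close> into the dual of \<open>A\<close>, whose order is \<open>r\<close> reversed. It is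
  computed pointwise, without passing to \<open>TTX\<close>, because a copresheaf \<open>G\<close> on the dual of \<open>TX\<close> already
  satisfies \<open>xiT \<T> TX (ev \<T> G) w \<le> ev \<T> G (mult \<T> X w)\<close>.
\<close>

definition left_kan :: "'a \<Rightarrow> 'a" where
  "left_kan G = fun_elt X (\<lambda>x. enc \<T> (SUP t\<in>elts TX. ev \<T> G t * r x (\<alpha> t)))"

lemma ev_precompose: "t \<in> elts TX \<Longrightarrow> ev \<T> (precompose F) t = ev \<T> F (\<alpha> t)"
  unfolding precompose_def by (rule ev_fun_elt)

lemma ev_left_kan: "x \<in> elts X \<Longrightarrow> ev \<T> (left_kan G) x = (SUP t\<in>elts TX. ev \<T> G t * r x (\<alpha> t))"
  unfolding left_kan_def by (rule ev_fun_elt)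

lemma precompose_in:
  assumes F: "F \<in> elts (presheaves \<T> D)"
  shows "precompose F \<in> elts (presheaves \<T> DT)"
proof -
  have "ev \<T> F (\<alpha> s) * rconv (hat \<T> A) s t \<le> ev \<T> F (\<alpha> t)"
    if s: "s \<in> elts TX" and t: "t \<in> elts TX" for s t
  proof -
    have "ev \<T> F (\<alpha> s) * rconv (hat \<T> A) s t \<le> ev \<T> F (\<alpha> s) * rconv r (\<alpha> s) (\<alpha> t)"
      unfolding rconv_def by (intro tensor_mono order_refl hat_le s t)
    also have "\<dots> \<le> ev \<T> F (\<alpha> t)"
      using D.presheaf_mono[OF F, of "\<alpha> s" "\<alpha> t"] by (simp add: objs closed s t)
    finally show ?thesis .
  qed
  moreover have "xiT \<T> TX (\<lambda>t. ev \<T> F (\<alpha> t)) w \<le> ev \<T> F (\<alpha> (mult \<T> X w))"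
    if w: "w \<in> elts (TO \<T> TX)" for w
  proof -
    have "xiT \<T> TX (\<lambda>t. ev \<T> F (\<alpha> t)) w = xiT \<T> X (ev \<T> F) (T\<alpha> w)"
      by (rule xiT_comp[OF alg_map w])
    also have "\<dots> \<le> ev \<T> F (\<alpha> (T\<alpha> w))"
      using D.presheaf_alg[OF F, of "T\<alpha> w"] by (simp add: objs closed w)
    also have "\<dots> \<le> ev \<T> F (\<alpha> (mult \<T> X w))"
      using D.presheaf_le[OF F, of "\<alpha> (T\<alpha> w)" "\<alpha> (mult \<T> X w)"] alg_mult(1)[OF w]
      by (simp add: objs closed w rconv_def)
    finally show ?thesis .
  qed
  ultimately show ?thesis
    unfolding precompose_def using DT.presheafI[of "\<lambda>t. ev \<T> F (\<alpha> t)"] by (simp add: objs)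
qed

text \<open>
  Both closure properties of the Kan extension, that it maps presheaves to presheaves
  (taking \<open>q\<close> principal) and that it is lax for the algebra structures, reduce to this inequality. The
  extended Kan extension is a supremum over \<open>w\<close> in \<open>TTX\<close>; each \<open>w\<close> is replaced by \<open>mult w\<close> in \<open>TX\<close>,
  using \<open>\<alpha> (T\<alpha> w) \<simeq> \<alpha> (mult w)\<close> for the order and reflexivity of the hat relation for \<open>mu\<close>.
\<close>

lemma Txi_left_kan_le:
  assumes q: "q \<in> elts (TO \<T> (presheaves \<T> DT))" and s: "s \<in> elts TX" and x: "x \<in> elts X"
  shows "Txi \<T> (presheaves \<T> DT) X (\<lambda>G x. SUP t\<in>elts TX. ev \<T> G t * r x (\<alpha> t)) q s * r x (\<alpha> s)
    \<le> (SUP t\<in>elts TX. mu \<T> DT q t * r x (\<alpha> t))"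
proof -
  let ?Q = "presheaves \<T> DT" and ?R = "SUP t\<in>elts TX. mu \<T> DT q t * r x (\<alpha> t)"
  let ?E = "Txi \<T> ?Q TX (ev \<T>)"
  have rc: "(\<lambda>G x. SUP t\<in>elts TX. ev \<T> G t * r x (\<alpha> t)) = rcomp TX (\<lambda>t x. rconv r (\<alpha> t) x) (ev \<T>)"
    by (intro ext) (simp add: rcomp_def rconv_def)
  show ?thesis
    unfolding rc Txi_rcomp SUP_tensor
  proof (rule SUP_least)
    fix w assume w: "w \<in> elts (TO \<T> TX)"
    have "Txi \<T> TX X (\<lambda>t x. rconv r (\<alpha> t) x) w s = Txi \<T> X X r s (T\<alpha> w)"
      by (simp add: Txi_comp_map[OF alg_map w, of X "rconv r" s] Txi_rconv)
    also have "\<dots> \<le> r (\<alpha> s) (\<alpha> (T\<alpha> w))" by (intro alg_mono closed s w)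
    finally have "Txi \<T> TX X (\<lambda>t x. rconv r (\<alpha> t) x) w s * r x (\<alpha> s) \<le> r (\<alpha> s) (\<alpha> (T\<alpha> w)) * r x (\<alpha> s)"
      by (rule tensor_mono) (rule order_refl)
    also have "\<dots> = r x (\<alpha> s) * r (\<alpha> s) (\<alpha> (T\<alpha> w))" by (rule mult.commute)
    also have "\<dots> \<le> r x (\<alpha> (T\<alpha> w))" by (intro trans closed s w x)
    also have "\<dots> \<le> r x (\<alpha> (mult \<T> X w))" by (intro le_trans_right alg_mult closed w x)
    finally have 1: "Txi \<T> TX X (\<lambda>t x. rconv r (\<alpha> t) x) w s * r x (\<alpha> s) \<le> r x (\<alpha> (mult \<T> X w))" .
    have "1 \<le> str DT w (mult \<T> X w)"
      using DT.str_eq[of w "mult \<T> X w"] hat_refl[OF tcategory, of "mult \<T> X w"]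
      by (simp add: objs rconv_def closed w)
    then have "?E q w \<le> ?E q w * str DT w (mult \<T> X w)"
      using unit_le_tensor[of "str DT w (mult \<T> X w)" "?E q w"] by (simp add: mult.commute)
    also have "\<dots> \<le> mu \<T> DT q (mult \<T> X w)"
      using mu_upper[of w DT q "mult \<T> X w"] by (simp add: objs w)
    finally have 2: "?E q w \<le> mu \<T> DT q (mult \<T> X w)" .
    have "?E q w * Txi \<T> TX X (\<lambda>t x. rconv r (\<alpha> t) x) w s * r x (\<alpha> s)
        \<le> mu \<T> DT q (mult \<T> X w) * r x (\<alpha> (mult \<T> X w))"
      using tensor_mono[OF 2 1] by (simp add: mult.assoc)
    also have "\<dots> \<le> ?R" by (intro SUP_upper closed w)
    finally show "?E q w * Txi \<T> TX X (\<lambda>t x. rconv r (\<alpha> t) x) w s * r x (\<alpha> s) \<le> ?R" .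
  qed
qed

lemma left_kan_in:
  assumes G: "G \<in> elts (presheaves \<T> DT)"
  shows "left_kan G \<in> elts (presheaves \<T> D)"
proof -
  let ?Q = "presheaves \<T> DT" and ?l = "\<lambda>G x. SUP t\<in>elts TX. ev \<T> G t * r x (\<alpha> t)"
  have "?l G x * rconv r x y \<le> ?l G y" if x: "x \<in> elts X" and y: "y \<in> elts X" for x y
    unfolding SUP_tensor
  proof (rule SUP_mono)
    fix t assume t: "t \<in> elts TX"
    have "ev \<T> G t * (r y x * r x (\<alpha> t)) \<le> ev \<T> G t * r y (\<alpha> t)"
      by (intro tensor_mono order_refl trans closed t x y)
    then show "\<exists>s\<in>elts TX. ev \<T> G t * r x (\<alpha> t) * rconv r x y \<le> ev \<T> G s * r y (\<alpha> s)"
      using t by (intro bexI[of _ t]) (simp_all add: rconv_def ac_simps)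
  qed
  moreover have "xiT \<T> X (?l G) s \<le> ?l G (\<alpha> s)" if s: "s \<in> elts TX" for s
  proof -
    have "xiT \<T> X (?l G) s = Txi \<T> ?Q X ?l (unit \<T> ?Q G) s" by (rule Txi_row[OF T1 G s, symmetric])
    also have "\<dots> \<le> Txi \<T> ?Q X ?l (unit \<T> ?Q G) s * r (\<alpha> s) (\<alpha> s)"
      using unit_le_tensor[OF refl[OF alg_in[OF s]], of "Txi \<T> ?Q X ?l (unit \<T> ?Q G) s"]
      by (simp add: mult.commute)
    also have "\<dots> \<le> (SUP t\<in>elts TX. mu \<T> DT (unit \<T> ?Q G) t * r (\<alpha> s) (\<alpha> t))"
      by (intro Txi_left_kan_le closed G s)
    also have "\<dots> = ?l G (\<alpha> s)"
      by (intro SUP_cong) (simp_all add: DT.mu_unit[OF G] objs)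
    finally show ?thesis .
  qed
  ultimately show ?thesis
    unfolding left_kan_def using D.presheafI[of "?l G"] by (simp add: objs)
qed

text \<open>
  Laxness reflects that \<open>\<alpha>\<close>, being a pseudo-homomorphism \<open>TX \<rightarrow> X\<close>, is also a functor between the duals.
\<close>

lemma precompose_functor: "tfunctor \<T> VDop (Pcat \<T> A) precompose"
proof -
  interpret presentation_pair \<T> VDop "rconv (presheaf_order D)" "presheaf_algebra D"
    "Pcat \<T> A" "rconv (presheaf_order DT)" "presheaf_algebra DT" ..
  let ?P = "presheaves \<T> D" and ?Q = "presheaves \<T> DT"
  have pre: "precompose \<in> elts ?P \<rightarrow> elts ?Q" using precompose_in by auto
  have mono: "presheaf_order D G F \<le> presheaf_order DT (precompose G) (precompose F)" for F G
    using presheaf_order_ev[of _ D G F] closed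
    by (intro le_presheaf_orderI) (simp add: objs ev_precompose)
  have lax: "mu \<T> DT (TM \<T> ?P ?Q precompose p) t \<le> mu \<T> D p (\<alpha> t)"
    if p: "p \<in> elts (TO \<T> ?P)" and t: "t \<in> elts TX" for p t
  proof (rule mu_least)
    fix w assume "w \<in> elts (TO \<T> (obj DT))"
    then have w: "w \<in> elts (TO \<T> TX)" by (simp add: objs)
    have "Txi \<T> ?Q TX (ev \<T>) (TM \<T> ?P ?Q precompose p) w = Txi \<T> ?P TX (\<lambda>F t. ev \<T> (precompose F) t) p w"
      by (rule Txi_comp_map[OF pre p, symmetric])
    also have "\<dots> = Txi \<T> ?P TX (\<lambda>F t. ev \<T> F (\<alpha> t)) p w"
      by (intro Txi_cong) (simp add: ev_precompose)
    also have "\<dots> = Txi \<T> ?P X (ev \<T>) p (T\<alpha> w)" by (rule Txi_comp_map_right[OF alg_map w])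
    finally have 1: "Txi \<T> ?Q TX (ev \<T>) (TM \<T> ?P ?Q precompose p) w = Txi \<T> ?P X (ev \<T>) p (T\<alpha> w)" .
    have "str DT w t = hat \<T> A t (mult \<T> X w)" using w t by (simp add: DT.str_eq objs rconv_def)
    also have "\<dots> \<le> r (\<alpha> t) (\<alpha> (mult \<T> X w))" by (intro hat_le closed w t)
    also have "\<dots> \<le> r (\<alpha> t) (\<alpha> (T\<alpha> w))" by (intro le_trans_right alg_mult closed w t)
    also have "\<dots> = str D (T\<alpha> w) (\<alpha> t)" using w t by (simp add: D.str_eq objs rconv_def closed)
    finally have "Txi \<T> ?P X (ev \<T>) p (T\<alpha> w) * str DT w t
        \<le> Txi \<T> ?P X (ev \<T>) p (T\<alpha> w) * str D (T\<alpha> w) (\<alpha> t)"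
      by (intro tensor_mono order_refl)
    also have "\<dots> \<le> mu \<T> D p (\<alpha> t)" using mu_upper[of "T\<alpha> w" D p "\<alpha> t"] w by (simp add: objs closed)
    finally show "Txi \<T> ?Q (obj DT) (ev \<T>) (TM \<T> ?P ?Q precompose p) w * str DT w t \<le> mu \<T> D p (\<alpha> t)"
      by (simp add: objs 1)
  qed
  show ?thesis
    unfolding tfunctor_iff using pre mono lax
    by (simp add: objs rconv_def unit_le_presheaf_order ev_presheaf_algebra ev_precompose closed)
qed

lemma left_kan_functor: "tfunctor \<T> (Pcat \<T> A) VDop left_kan"
proof -
  interpret presentation_pair \<T> "Pcat \<T> A" "rconv (presheaf_order DT)" "presheaf_algebra DT"
    VDop "rconv (presheaf_order D)" "presheaf_algebra D" ..
  let ?P = "presheaves \<T> D" and ?Q = "presheaves \<T> DT"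
  let ?l = "\<lambda>G x. SUP t\<in>elts TX. ev \<T> G t * r x (\<alpha> t)"
  have kan: "left_kan \<in> elts ?Q \<rightarrow> elts ?P" using left_kan_in by auto
  have mono: "presheaf_order DT G F \<le> presheaf_order D (left_kan G) (left_kan F)" for F G
  proof (rule le_presheaf_orderI)
    fix x assume "x \<in> elts (obj D)"
    moreover have "presheaf_order DT G F * (ev \<T> F t * r x (\<alpha> t)) \<le> ev \<T> G t * r x (\<alpha> t)"
      if "t \<in> elts TX" for t
      using tensor_mono[OF presheaf_order_ev[of t DT G F] order_refl, of "r x (\<alpha> t)"] that
      by (simp add: objs mult.assoc)
    ultimately show "presheaf_order DT G F * ev \<T> (left_kan F) x \<le> ev \<T> (left_kan G) x"
      by (auto simp: objs ev_left_kan tensor_SUP intro!: SUP_mono)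
  qed
  have lax: "mu \<T> D (TM \<T> ?Q ?P left_kan q) x \<le> (SUP t\<in>elts TX. mu \<T> DT q t * r x (\<alpha> t))"
    if q: "q \<in> elts (TO \<T> ?Q)" and x: "x \<in> elts X" for q x
  proof (rule mu_least)
    fix s assume "s \<in> elts (TO \<T> (obj D))"
    then have s: "s \<in> elts TX" by (simp add: objs)
    have "Txi \<T> ?P X (ev \<T>) (TM \<T> ?Q ?P left_kan q) s = Txi \<T> ?Q X (\<lambda>G x. ev \<T> (left_kan G) x) q s"
      by (rule Txi_comp_map[OF kan q, symmetric])
    also have "\<dots> = Txi \<T> ?Q X ?l q s"
      by (intro Txi_cong) (simp add: ev_left_kan)
    finally show "Txi \<T> ?P (obj D) (ev \<T>) (TM \<T> ?Q ?P left_kan q) s * str D s x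
        \<le> (SUP t\<in>elts TX. mu \<T> DT q t * r x (\<alpha> t))"
      using Txi_left_kan_le[OF q s x] s x by (simp add: D.str_eq objs rconv_def)
  qed
  have "ev \<T> (left_kan (presheaf_algebra DT q)) x = (SUP t\<in>elts TX. mu \<T> DT q t * r x (\<alpha> t))"
    if "x \<in> elts X" for q x
    unfolding ev_left_kan[OF that] by (intro SUP_cong) (simp_all add: ev_presheaf_algebra objs)
  then show ?thesis
    unfolding tfunctor_iff using kan mono lax
    by (simp add: objs rconv_def unit_le_presheaf_order ev_presheaf_algebra)
qed

lemma left_kan_adjoint: "adjoint \<T> (Pcat \<T> A) VDop left_kan precompose"
proof -
  interpret presentation_pair \<T> "Pcat \<T> A" "rconv (presheaf_order DT)" "presheaf_algebra DT"
    VDop "rconv (presheaf_order D)" "presheaf_algebra D" ..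
  have "ev \<T> G t \<le> (SUP s\<in>elts TX. ev \<T> G s * r (\<alpha> t) (\<alpha> s))" if t: "t \<in> elts TX" for G t
    using unit_le_tensor[OF refl[OF alg_in[OF t]], of "ev \<T> G t"] t
    by (intro SUP_upper2[of t]) (simp_all add: mult.commute)
  moreover have "(SUP t\<in>elts TX. ev \<T> (precompose F) t * r x (\<alpha> t)) \<le> ev \<T> F x"
    if F: "F \<in> elts (presheaves \<T> D)" and x: "x \<in> elts X" for F x
    using D.presheaf_mono[OF F, of "\<alpha> _" x] x
    by (intro SUP_least) (simp add: ev_precompose objs rconv_def closed)
  ultimately show ?thesis
    unfolding adjoint_iff using precompose_functor left_kan_functor
    by (simp add: objs rconv_def unit_le_presheaf_order ev_precompose ev_left_kan closed)
qed

text \<open>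
  Each \<open>x\<close> is equivalent to \<open>\<alpha> (unit x)\<close>, and presheaves identify equivalent elements.
\<close>

lemma precompose_reflects:
  assumes F: "F \<in> elts (presheaves \<T> D)" and G: "G \<in> elts (presheaves \<T> D)"
    and le: "1 \<le> rconv (presheaf_order DT) (precompose F) (precompose G)"
  shows "1 \<le> rconv (presheaf_order D) F G"
  unfolding rconv_def unit_le_presheaf_order
proof
  fix x assume "x \<in> elts (obj D)"
  then have x: "x \<in> elts X" by (simp add: objs)
  let ?y = "\<alpha> (unit \<T> X x)"
  have "ev \<T> F x \<le> ev \<T> F ?y"
    using D.presheaf_le[OF F, of x ?y] x by (simp add: objs rconv_def alg_unit closed)
  also have "\<dots> \<le> ev \<T> G ?y"
    using le unit_in[OF x] unfolding rconv_def unit_le_presheaf_order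
    by (auto simp: objs ev_precompose)
  also have "\<dots> \<le> ev \<T> G x"
    using D.presheaf_le[OF G, of ?y x] x by (simp add: objs rconv_def alg_unit closed)
  finally show "ev \<T> F x \<le> ev \<T> G x" .
qed

lemma ymap_eq: "x \<in> elts X \<Longrightarrow> ymap \<T> A x = precompose (hmap \<T> D x)"
  unfolding ymap_def precompose_def
  by (rule fun_elt_cong) (simp add: D.ev_hmap objs closed str_eq rconv_def)

lemma hmap_opposite: "pseudo_hom \<T> A VDop (hmap \<T> D)"
proof -
  interpret DV: presentation_pair \<T> D "rconv r" \<alpha> "Vcat \<T> D" "presheaf_order D" "presheaf_algebra D" ..
  have "rconv (rconv r) = r" by (intro ext) (simp add: rconv_def)
  then have "presentation_pair \<T> A (rconv (rconv r)) \<alpha> VDop (rconv (presheaf_order D)) (presheaf_algebra D)"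
    using algebra_presentation_axioms VDop.algebra_presentation_axioms by (simp add: presentation_pair_def)
  then show ?thesis by (rule DV.pseudo_hom_opposite[OF D.hmap_pseudo_hom[OF T1]]) (simp_all add: objs)
qed

text \<open>
  The pseudo-homomorphism condition on the right adjoint is exactly what allows it to be
  dualised; on the dual side it becomes a left adjoint, for which the condition is automatic.
\<close>

lemma totally_complete_dual_iff:
  "totally_complete \<T> D \<longleftrightarrow> (\<exists>g. adjoint \<T> VDop A g (hmap \<T> D))"
proof -
  interpret DV: presentation_pair \<T> D "rconv r" \<alpha> "Vcat \<T> D" "presheaf_order D" "presheaf_algebra D" ..
  interpret VA: presentation_pair \<T> VDop "rconv (presheaf_order D)" "presheaf_algebra D" A r \<alpha> ..
  interpret VV: presentation_pair \<T> "Vcat \<T> D" "presheaf_order D" "presheaf_algebra D" D "rconv r" \<alpha> ..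
  have rr: "rconv (rconv s) = s" for s :: "'a \<Rightarrow> 'a \<Rightarrow> 'b" by (intro ext) (simp add: rconv_def)
  have op: "presentation_pair \<T> VDop (rconv (presheaf_order D)) (presheaf_algebra D) A (rconv (rconv r)) \<alpha>"
    unfolding rr by unfold_locales
  let ?h = "hmap \<T> D"
  have h: "pseudo_hom \<T> D (Vcat \<T> D) ?h" by (rule D.hmap_pseudo_hom[OF T1])
  note h_op = hmap_opposite
  have "adjoint \<T> D (Vcat \<T> D) ?h g \<and> pseudo_hom \<T> (Vcat \<T> D) D g \<longleftrightarrow> adjoint \<T> VDop A g ?h" for g
  proof
    assume g: "adjoint \<T> D (Vcat \<T> D) ?h g \<and> pseudo_hom \<T> (Vcat \<T> D) D g"
    then have "pseudo_hom \<T> VDop A g"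
      by (intro VV.pseudo_hom_opposite[OF _ op]) (simp_all add: objs)
    then show "adjoint \<T> VDop A g ?h"
      using g h_op by (simp add: DV.adjoint_iff VA.adjoint_iff pseudo_hom_def objs rconv_def)
  next
    assume g: "adjoint \<T> VDop A g ?h"
    then have "pseudo_hom \<T> VDop A g" by (rule VA.left_adjoint_pseudo_hom)
    then have "pseudo_hom \<T> (Vcat \<T> D) D g"
      by (rule VA.pseudo_hom_opposite) (simp_all add: rr objs VV.presentation_pair_axioms)
    then show "adjoint \<T> D (Vcat \<T> D) ?h g \<and> pseudo_hom \<T> (Vcat \<T> D) D g"
      using g h by (simp add: DV.adjoint_iff VA.adjoint_iff pseudo_hom_def objs rconv_def)
  qed
  then show ?thesis by (simp add: totally_complete_def D.representable)
qed

lemma totally_cocomplete_iff: "totally_cocomplete \<T> A \<longleftrightarrow> totally_complete \<T> D"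
proof -
  have PV: "presentation_pair \<T> (Pcat \<T> A) (rconv (presheaf_order DT)) (presheaf_algebra DT)
      VDop (rconv (presheaf_order D)) (presheaf_algebra D)"
    and VA: "presentation_pair \<T> VDop (rconv (presheaf_order D)) (presheaf_algebra D) A r \<alpha>"
    by unfold_locales
  interpret PA: presentation_pair \<T> "Pcat \<T> A" "rconv (presheaf_order DT)" "presheaf_algebra DT" A r \<alpha> ..
  let ?h = "hmap \<T> D"
  have y: "adjoint \<T> (Pcat \<T> A) A f (ymap \<T> A) \<longleftrightarrow> adjoint \<T> (Pcat \<T> A) A f (\<lambda>x. precompose (?h x))" for f
  proof (cases "tfunctor \<T> (Pcat \<T> A) A f")
    case True
    then have "\<And>p. p \<in> elts (obj (Pcat \<T> A)) \<Longrightarrow> f p \<in> elts X" by (auto simp: tfunctor_def)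
    then show ?thesis
      using tfunctor_cong[of A "ymap \<T> A" "\<lambda>x. precompose (?h x)" "Pcat \<T> A", OF ymap_eq]
      by (simp add: PA.adjoint_iff ymap_eq)
  qed (simp add: adjoint_def)
  have "tfunctor \<T> A VDop ?h" using hmap_opposite by (simp add: pseudo_hom_def)
  then have "\<exists>g. adjoint \<T> VDop A g ?h" if "adjoint \<T> (Pcat \<T> A) A f (\<lambda>x. precompose (?h x))" for f
    using adjoint_cancel[OF PV VA that precompose_functor] precompose_reflects objs by auto
  moreover have "\<exists>f. adjoint \<T> (Pcat \<T> A) A f (\<lambda>x. precompose (?h x))" if "adjoint \<T> VDop A g ?h" for g
    using adjoint_comp[OF PV VA left_kan_adjoint that] by blast
  ultimately show ?thesis
    unfolding totally_cocomplete_def totally_complete_dual_iff y by blast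
qed

end

theorem proposition7p3:
  fixes \<T> :: "('u::grothendieck_universe, 'v::comm_quantale) ttheory"
    and X :: "('u, 'v) tcat"
  assumes "topological_theory \<T>"
    and "(bot::'v) \<noteq> 1"
    and "\<exists>t. elts (TO \<T> one) = {t}"
    and "representable \<T> X"
  shows "totally_cocomplete \<T> X \<longleftrightarrow> totally_complete \<T> (dual \<T> X)"
proof -
  interpret topological_theory \<T> by fact
  interpret algebra_presentation \<T> X "str0 \<T> X" "rep_map \<T> X"
    by (rule representable_presentation) fact
  interpret representable_dual \<T> X "str0 \<T> X" "rep_map \<T> X"
    by unfold_locales fact
  show ?thesis by (rule totally_cocomplete_iff)
qed

end
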